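(* Let $G$ be a simple planar graph that is rationally $K_3$-decomposable. Then $G$ has a rational $K_3$-decomposition in which every triangle receives a weight in $\{0,1,\tfrac12\}$.
   Context: A rational $K_3$-decomposition of a graph $G$ is an assignment of nonnegative rational weights to the triangles (copies of $K_3$) of $G$ such that for every edge $e$ of $G$, the sum of the weights of the triangles containing $e$ equals $1$. $G$ is rationally $K_3$-decomposable if it admits such an assignment. *)

theory Defs
  imports "HOL-Analysis.Analysis"
begin

(* A graph is a vertex set V together with a set E of two-element subsets of V;
   graphs are finite. *)
definition simple_graph :: "'a set \<Rightarrow> 'a set set \<Rightarrow> bool" where
  "simple_graph V E \<longleftrightarrow> finite V \<and> (\<forall>e\<in>E. e \<subseteq> V \<and> card e = 2)"

definition arc_interior :: "(real \<Rightarrow> complex) \<Rightarrow> complex set" where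
  "arc_interior g = path_image g - {pathstart g, pathfinish g}"

(* p places the vertices; g e is a parametrization of the arc representing the edge e,
   in either of its two directions. *)
definition plane_drawing ::
    "'a set \<Rightarrow> 'a set set \<Rightarrow> ('a \<Rightarrow> complex) \<Rightarrow> ('a set \<Rightarrow> real \<Rightarrow> complex) \<Rightarrow> bool" where
  "plane_drawing V E p g \<longleftrightarrow>
     inj_on p V \<and>
     (\<forall>e\<in>E. arc (g e) \<and> {pathstart (g e), pathfinish (g e)} = p ` e) \<and>
     (\<forall>e\<in>E. arc_interior (g e) \<inter> p ` V = {}) \<and>
     (\<forall>e\<in>E. \<forall>f\<in>E. e \<noteq> f \<longrightarrow> arc_interior (g e) \<inter> path_image (g f) = {})"

definition planar_graph :: "'a set \<Rightarrow> 'a set set \<Rightarrow> bool" where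
  "planar_graph V E \<longleftrightarrow> (\<exists>p g. plane_drawing V E p g)"

(* In a simple graph a copy of K3 is determined by its three vertices, so triangles are
   represented by vertex sets; the triangle t contains the edge e iff e is a subset of t. *)
definition triangles :: "'a set \<Rightarrow> 'a set set \<Rightarrow> 'a set set" where
  "triangles V E = {t. t \<subseteq> V \<and> card t = 3 \<and> (\<forall>u\<in>t. \<forall>v\<in>t. u \<noteq> v \<longrightarrow> {u, v} \<in> E)}"

definition rational_K3_decomposition ::
    "'a set \<Rightarrow> 'a set set \<Rightarrow> ('a set \<Rightarrow> rat) \<Rightarrow> bool" where
  "rational_K3_decomposition V E w \<longleftrightarrow>
     (\<forall>t\<in>triangles V E. 0 \<le> w t) \<and>
     (\<forall>e\<in>E. (\<Sum>t\<in>{t \<in> triangles V E. e \<subseteq> t}. w t) = 1)"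

definition rationally_K3_decomposable :: "'a set \<Rightarrow> 'a set set \<Rightarrow> bool" where
  "rationally_K3_decomposable V E \<longleftrightarrow> (\<exists>w. rational_K3_decomposition V E w)"

end

theory Submission
  imports Defs
begin

text \<open>Fix a plane drawing. If no vertex lies inside a triangle, every edge is in at most two
  triangles, so replacing every fractional weight by \<open>1/2\<close> keeps all edge sums equal to \<open>1\<close>.
  Otherwise take a triangle \<open>T\<close> with a minimal nonempty set of vertices inside. Each edge strictly
  inside \<open>T\<close> is in at most two triangles and each edge of \<open>T\<close> is in at most one triangle drawn
  inside \<open>T\<close>. A parity count and a count modulo 3 show that the triangles inside \<open>T\<close> either
  contribute the same amount \<open>x\<close> to the three edges of \<open>T\<close>, or contribute \<open>0\<close> or \<open>1\<close> to each of them.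
  In the first case delete the vertices inside \<open>T\<close> and raise the weight of \<open>T\<close> by \<open>x\<close>; in the second
  one delete them together with the edges of \<open>T\<close> to which \<open>1\<close> is contributed. Apply induction to the
  smaller graph and put back the inner triangles with rounded weights.

  To make the first case work, the induction also asserts that the new weights are at least the
  old ones rounded down to a multiple of \<open>1/2\<close>: then \<open>T\<close> has enough weight to give back the
  rounded value of \<open>x\<close> to the inner triangles.\<close>

section \<open>Rounding weights to multiples of one half\<close>

definition floor2 :: "rat \<Rightarrow> rat" where
  "floor2 q = of_int \<lfloor>2 * q\<rfloor> / 2"

lemma floor2_nonneg: "0 \<le> q \<Longrightarrow> 0 \<le> floor2 q"
  unfolding floor2_def by simp

text \<open>Superadditivity is what later allows \<open>floor2 x\<close> to be taken back from a
  triangle whose weight had been raised by \<open>x\<close>.\<close>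

lemma floor2_add: "floor2 p + floor2 q \<le> floor2 (p + q)"
  unfolding floor2_def using le_floor_add[of "2 * p" "2 * q"]
  by (simp add: distrib_left flip: add_divide_distrib of_int_add)

lemma half_integral_floor2: "2 * floor2 q \<in> \<int>"
  unfolding floor2_def by simp

text \<open>The complement rule preserves the sum 1 at an edge lying in two triangles. The bound by
  \<open>floor2\<close> is the extra assertion carried through the induction.\<close>

definition rounding :: "(rat \<Rightarrow> rat) \<Rightarrow> bool" where
  "rounding \<phi> \<longleftrightarrow> \<phi> 0 = 0 \<and> \<phi> 1 = 1 \<and>
     (\<forall>q\<in>{0..1}. \<phi> q + \<phi> (1 - q) = 1 \<and> floor2 q \<le> \<phi> q \<and> 2 * \<phi> q \<in> \<int>)"

lemma floor2_eq:
  assumes "0 \<le> q" "q \<le> 1"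
  shows "floor2 q = (if q < 1/2 then 0 else if q < 1 then 1/2 else 1)"
proof -
  consider "q < 1/2" | "1/2 \<le> q" "q < 1" | "q = 1" using assms by linarith
  then show ?thesis
  proof cases
    case 1
    then have "\<lfloor>2 * q\<rfloor> = 0" using assms by (simp add: floor_eq_iff)
    with 1 show ?thesis by (simp add: floor2_def)
  next
    case 2
    then have "\<lfloor>2 * q\<rfloor> = 1" by (simp add: floor_eq_iff)
    with 2 show ?thesis by (simp add: floor2_def)
  qed (simp add: floor2_def)
qed

text \<open>No single rounding agrees with \<open>floor2\<close> everywhere: for \<open>q\<close>
  strictly between 0 and 1/2, \<open>floor2 q + floor2 (1 - q)\<close> is only 1/2. So the rounding
  depends on \<open>x\<close>: below 1/2, weights go to the nearer of 0 and 1; from 1/2 on, every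
  fractional weight becomes 1/2.\<close>

lemma ex_rounding:
  assumes "0 \<le> x" "x \<le> 1"
  obtains \<phi> where "rounding \<phi>" "\<phi> x = floor2 x"
proof (cases "x < 1/2")
  case True
  let ?\<phi> = "\<lambda>q::rat. if q < 1/2 then 0 else if q = 1/2 then 1/2 else 1::rat"
  have "rounding ?\<phi>" unfolding rounding_def by (auto simp: floor2_eq)
  then show ?thesis using that True assms by (force simp: floor2_eq)
next
  case False
  let ?\<phi> = "\<lambda>q::rat. if 0 < q \<and> q < 1 then 1/2 else q::rat"
  have "rounding ?\<phi>" unfolding rounding_def by (auto simp: floor2_eq)
  then show ?thesis using that False assms by (force simp: floor2_eq)
qed

lemma sum_rounding_one:
  assumes \<phi>: "rounding \<phi>" and S: "finite S" "card S \<le> 2" "\<forall>s\<in>S. 0 \<le> w s" "sum w S = 1"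
  shows "(\<Sum>s\<in>S. \<phi> (w s)) = 1"
proof -
  consider "S = {}" | s where "S = {s}" | s s' where "S = {s, s'}" "s \<noteq> s'"
  proof -
    have "card S = 0 \<or> card S = 1 \<or> card S = 2" using S(2) by linarith
    then show thesis using that S(1) by (auto simp: card_1_singleton_iff card_2_iff)
  qed
  then show ?thesis
  proof cases
    case 3
    then have "w s' = 1 - w s" "w s \<in> {0..1}" using S by auto
    then show ?thesis using 3 \<phi> unfolding rounding_def by simp
  qed (use S \<phi> in \<open>auto simp: rounding_def\<close>)
qed

text \<open>A rounding is not additive, but with at most one summand there is nothing to add; the
  empty sum is covered by \<open>\<phi> 0 = 0\<close>. This serves the edges of the innermost
  triangle.\<close>

lemma sum_rounding_single:
  assumes "rounding \<phi>" "finite S" "card S \<le> 1"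
  shows "(\<Sum>s\<in>S. \<phi> (w s)) = \<phi> (sum w S)"
proof -
  consider "S = {}" | s where "S = {s}"
  proof -
    have "card S = 0 \<or> card S = 1" using assms(3) by linarith
    then show thesis using that assms(2) by (auto simp: card_1_singleton_iff)
  qed
  then show ?thesis using assms(1) by cases (auto simp: rounding_def)
qed

section \<open>Double counting of incidences between triangles and edges\<close>

lemma sum_incidence_swap:
  fixes f :: "'a set \<Rightarrow> int"
  assumes "finite F" "finite K"
  shows "(\<Sum>s\<in>K. f s * int (card {e\<in>F. e \<subseteq> s})) = (\<Sum>e\<in>F. \<Sum>s\<in>{s\<in>K. e \<subseteq> s}. f s)"
proof -
  have "(\<Sum>e\<in>F. \<Sum>s\<in>{s\<in>K. e \<subseteq> s}. f s) = (\<Sum>s\<in>K. \<Sum>e\<in>{e\<in>F. e \<subseteq> s}. f s)"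
    using assms by (intro sum.swap_restrict)
  also have "\<dots> = (\<Sum>s\<in>K. f s * int (card {e\<in>F. e \<subseteq> s}))" by (simp add: mult.commute)
  finally show ?thesis by simp
qed

lemma card_two_other:
  assumes "card e = 2" "u \<in> e"
  obtains v where "e = {u, v}" "v \<noteq> u"
  using assms by (metis card_2_iff insertE insert_commute singletonD)

lemma two_subsets_of_triple:
  assumes "a \<noteq> b" "a \<noteq> c" "b \<noteq> c"
  shows "{e. e \<subseteq> {a, b, c} \<and> card e = 2} = {{a, b}, {a, c}, {b, c}}"
proof (intro equalityI subsetI)
  fix e assume "e \<in> {e. e \<subseteq> {a, b, c} \<and> card e = 2}"
  then obtain u v where "e = {u, v}" "u \<noteq> v" "u \<in> {a, b, c}" "v \<in> {a, b, c}"
    by (auto simp: card_2_iff)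
  then show "e \<in> {{a, b}, {a, c}, {b, c}}" by auto
qed (use assms in auto)

lemma card_two_subsets_at:
  assumes "card s = 3" "x \<in> s"
  shows "card {e. e \<subseteq> s \<and> card e = 2 \<and> x \<in> e} = 2"
proof -
  have "card (s - {x}) = 2" using assms by (simp add: card.remove)
  then obtain y z where yz: "s - {x} = {y, z}" "y \<noteq> z" by (auto simp: card_2_iff)
  then have s: "s = {x, y, z}" "x \<noteq> y" "x \<noteq> z" using assms(2) by auto
  have "{e. e \<subseteq> s \<and> card e = 2 \<and> x \<in> e} = {e \<in> {{x, y}, {x, z}, {y, z}}. x \<in> e}"
    using two_subsets_of_triple[OF s(2,3) yz(2)] s(1) by blast
  also have "\<dots> = {{x, y}, {x, z}}" using s by auto
  finally show ?thesis using yz(2) by (auto simp: doubleton_eq_iff)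
qed

text \<open>The triangles of fractional weight \<open>v\<close> or \<open>1 - v\<close> in a disk bounded by
  \<open>T\<close> pair up along the inner edges. Counting their edges at a vertex of \<open>T\<close> modulo 2 shows that
  they cover all or none of the edges of \<open>T\<close>; counting all their edges with signs modulo 3
  shows that those at the edges of \<open>T\<close> have the same weight.\<close>

lemma boundary_dichotomy:
  fixes w :: "'a set \<Rightarrow> rat"
  assumes H: "finite H" "\<And>t. t \<in> H \<Longrightarrow> card t = 3 \<and> 0 \<le> w t"
    and T: "card T = 3"
    and inner_sum: "\<And>t e. t \<in> H \<Longrightarrow> e \<subseteq> t \<Longrightarrow> card e = 2 \<Longrightarrow> \<not> e \<subseteq> T \<Longrightarrow>
      (\<Sum>s\<in>{s \<in> H. e \<subseteq> s}. w s) = 1 \<and> card {s \<in> H. e \<subseteq> s} \<le> 2"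
    and outer: "\<And>e. e \<subseteq> T \<Longrightarrow> card e = 2 \<Longrightarrow>
      card {s \<in> H. e \<subseteq> s} \<le> 1 \<and> (\<Sum>s\<in>{s \<in> H. e \<subseteq> s}. w s) \<le> 1"
  shows "(\<exists>x. \<forall>e. e \<subseteq> T \<and> card e = 2 \<longrightarrow> (\<Sum>s\<in>{s \<in> H. e \<subseteq> s}. w s) = x) \<or>
    (\<forall>e. e \<subseteq> T \<and> card e = 2 \<longrightarrow> (\<Sum>s\<in>{s \<in> H. e \<subseteq> s}. w s) \<in> {0, 1})"
proof (rule disjCI)
  let ?c = "\<lambda>e. \<Sum>s\<in>{s \<in> H. e \<subseteq> s}. w s"
  assume "\<not> (\<forall>e. e \<subseteq> T \<and> card e = 2 \<longrightarrow> ?c e \<in> {0, 1})"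
  then obtain e0 where e0: "e0 \<subseteq> T" "card e0 = 2" and c0: "?c e0 \<noteq> 0" "?c e0 \<noteq> 1" by auto
  define v where "v = ?c e0"
  \<comment> \<open>\<open>K\<close> is closed under crossing an inner edge: the weights at such an
    edge sum to 1, so a triangle of weight \<open>v\<close> faces one of weight \<open>1 - v\<close>
    and conversely.\<close>
  define K where "K = {s \<in> H. w s = v \<or> w s = 1 - v}"
  have v: "0 < v" "v < 1"
    using c0 outer[OF e0] sum_nonneg[of "{s \<in> H. e0 \<subseteq> s}" w] H(2) unfolding v_def by force+
  have finK: "finite K" using H(1) by (simp add: K_def)
  have single: "\<exists>s. {s \<in> K. e \<subseteq> s} = {s} \<and> {s \<in> H. e \<subseteq> s} = {s}"
    if e: "e \<subseteq> T" "card e = 2" "{s \<in> K. e \<subseteq> s} \<noteq> {}" for e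
  proof -
    have "{s \<in> K. e \<subseteq> s} \<subseteq> {s \<in> H. e \<subseteq> s}" by (auto simp: K_def)
    moreover obtain s where s: "s \<in> {s \<in> K. e \<subseteq> s}" using e(3) by blast
    moreover have "\<forall>s\<in>{s \<in> H. e \<subseteq> s}. \<forall>s'\<in>{s \<in> H. e \<subseteq> s}. s = s'"
      using outer[OF e(1,2)] H(1) by (subst card_le_Suc0_iff_eq[symmetric]) auto
    ultimately have "{s \<in> H. e \<subseteq> s} = {s}" by (intro equalityI subsetI) auto
    then show ?thesis using s by (auto simp: K_def)
  qed
  \<comment> \<open>As \<open>0 < v < 1\<close>, a triangle of \<open>K\<close> cannot supply the
    sum 1 at an inner edge alone. With at most two triangles there, exactly one partner
    remains.\<close>
  have pair: "\<exists>s s'. {s \<in> K. e \<subseteq> s} = {s, s'} \<and> s \<noteq> s' \<and> w s' = 1 - w s"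
    if e: "\<not> e \<subseteq> T" "card e = 2" "{s \<in> K. e \<subseteq> s} \<noteq> {}" for e
  proof -
    let ?S = "{s \<in> H. e \<subseteq> s}"
    obtain s where s: "s \<in> K" "e \<subseteq> s" using e(3) by blast
    then have sS: "s \<in> ?S" by (simp add: K_def)
    have S: "sum w ?S = 1" "card ?S \<le> 2" using inner_sum[of s e] s e by (auto simp: K_def)
    have "w s \<noteq> 1" using s(1) v by (auto simp: K_def)
    then have "?S \<noteq> {s}" using S(1) by auto
    then have "card ?S \<noteq> 1" using sS by (metis card_1_singletonE singletonD)
    moreover have "card ?S \<noteq> 0" using sS H(1) by auto
    ultimately have "card ?S = 2" using S(2) by linarith
    then obtain s' where s': "?S = {s, s'}" "s' \<noteq> s"
      using card_two_other[OF _ sS] by blast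
    then have w: "w s' = 1 - w s" using S(1) by simp
    then have "s' \<in> K" using s' s(1) by (auto simp: K_def)
    then have "{s \<in> K. e \<subseteq> s} = {s, s'}" using s' s(1) by (auto simp: K_def)
    with s' w show ?thesis by blast
  qed
  \<comment> \<open>\<open>F\<close> contains every pair that can matter; pairs in no triangle of
    \<open>K\<close> contribute 0 to all counts. Adding \<open>T\<close> to the union ensures that
    the boundary pairs \<open>B\<close> lie in \<open>F\<close>.\<close>
  define F where "F = {e. e \<subseteq> \<Union>K \<union> T \<and> card e = 2}"
  have "finite t" if "t \<in> K" for t
    using H(2)[of t] that by (intro card_ge_0_finite) (simp add: K_def)
  moreover have finT: "finite T" using T by (metis card.infinite zero_neq_numeral)
  ultimately have finF: "finite F" unfolding F_def using finK by simp
  define B where "B = {e. e \<subseteq> T \<and> card e = 2}"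
  have B: "B \<subseteq> F" unfolding B_def F_def by blast
  \<comment> \<open>Incidences of triangles in \<open>K\<close> with their edges at \<open>x\<close>
    are counted in two ways. A triangle at \<open>x\<close> has two edges there, so the total is
    even; an inner edge contributes 0 or 2. Hence the two boundary edges at \<open>x\<close>, each
    contributing 0 or 1, contribute equally.\<close>
  have parity: "card {s \<in> K. {x, y} \<subseteq> s} = card {s \<in> K. {x, z} \<subseteq> s}"
    if xyz: "T = {x, y, z}" "x \<noteq> y" "x \<noteq> z" "y \<noteq> z" for x y z
  proof -
    let ?N = "\<lambda>e. int (card {s \<in> K. e \<subseteq> s})"
    let ?Fx = "{e \<in> F. x \<in> e}" and ?Bx = "{e \<in> B. x \<in> e}"
    have "(\<Sum>s\<in>K. 1 * int (card {e \<in> ?Fx. e \<subseteq> s})) = (\<Sum>e\<in>?Fx. \<Sum>s\<in>{s\<in>K. e \<subseteq> s}. 1)"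
      using finF finK by (intro sum_incidence_swap) auto
    then have count: "(\<Sum>s\<in>K. int (card {e \<in> ?Fx. e \<subseteq> s})) = sum ?N ?Fx" by simp
    have "even (card {e \<in> ?Fx. e \<subseteq> s})" if s: "s \<in> K" for s
    proof (cases "x \<in> s")
      case True
      have "{e \<in> ?Fx. e \<subseteq> s} = {e. e \<subseteq> s \<and> card e = 2 \<and> x \<in> e}" using s by (auto simp: F_def)
      then show ?thesis using card_two_subsets_at[OF _ True] H(2) s by (simp add: K_def)
    next
      case False
      then have "{e \<in> ?Fx. e \<subseteq> s} = {}" by blast
      then show ?thesis by (simp only: card.empty) simp
    qed
    then have "even (\<Sum>s\<in>K. int (card {e \<in> ?Fx. e \<subseteq> s}))" by (intro dvd_sum) simp
    then have "even (sum ?N ?Fx)" using count by simp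
    also have "sum ?N ?Fx = sum ?N (?Fx - ?Bx) + sum ?N ?Bx"
      using finF B by (intro sum.subset_diff) auto
    finally have "even (sum ?N (?Fx - ?Bx) + sum ?N ?Bx)" .
    moreover have "even (sum ?N (?Fx - ?Bx))"
    proof (rule dvd_sum)
      fix e assume "e \<in> ?Fx - ?Bx"
      then have e: "\<not> e \<subseteq> T" "card e = 2" by (auto simp: F_def B_def)
      show "even (?N e)"
      proof (cases "{s \<in> K. e \<subseteq> s} = {}")
        case False
        then obtain s s' where "{s \<in> K. e \<subseteq> s} = {s, s'}" "s \<noteq> s'" using pair[OF e] by blast
        then show ?thesis by simp
      qed (simp only: card.empty, simp)
    qed
    ultimately have "even (sum ?N ?Bx)" by simp
    moreover have "?Bx = {{x, y}, {x, z}}"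
      using two_subsets_of_triple[OF xyz(2-4)] xyz unfolding B_def by auto
    moreover have "{x, y} \<noteq> {x, z}" using xyz by (simp add: doubleton_eq_iff)
    ultimately have "even (?N {x, y} + ?N {x, z})" by simp
    moreover have N01: "?N e \<in> {0, 1}" if e: "e \<subseteq> T" "card e = 2" for e
    proof (cases "{s \<in> K. e \<subseteq> s} = {}")
      case False
      then obtain s where "{s \<in> K. e \<subseteq> s} = {s}" using single[OF e] by blast
      then show ?thesis by simp
    qed (simp only: card.empty, simp)
    have "{x, y} \<subseteq> T" "card {x, y} = 2" "{x, z} \<subseteq> T" "card {x, z} = 2" using xyz by auto
    then have "?N {x, y} \<in> {0, 1}" "?N {x, z} \<in> {0, 1}" using N01 by blast+
    ultimately show ?thesis by auto
  qed
  obtain a b where ab: "e0 = {a, b}" "a \<noteq> b" using e0(2) by (auto simp: card_2_iff)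
  have "card (T - e0) = 1" using e0 T finT by (simp add: card_Diff_subset finite_subset)
  then obtain c where "T - e0 = {c}" by (rule card_1_singletonE)
  then have abc: "T = {a, b, c}" "a \<noteq> c" "b \<noteq> c" using ab e0(1) by auto
  have B_eq: "B = {{a, b}, {a, c}, {b, c}}"
    unfolding B_def abc(1) by (rule two_subsets_of_triple[OF ab(2) abc(2,3)])
  \<comment> \<open>The nonzero sum at \<open>e0\<close> comes from a single triangle, which
    therefore has weight \<open>v\<close>. Parity at \<open>a\<close> and at \<open>b\<close> then
    carries the covering to the other two edges of \<open>T\<close>.\<close>
  have "{s \<in> K. {a, b} \<subseteq> s} \<noteq> {}"
  proof -
    have "{s \<in> H. e0 \<subseteq> s} \<noteq> {}" using c0(1) by (metis sum.empty)
    then have "card {s \<in> H. e0 \<subseteq> s} \<noteq> 0" using H(1) by simp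
    then have "card {s \<in> H. e0 \<subseteq> s} = 1" using outer[OF e0] by linarith
    then obtain s where "{s \<in> H. e0 \<subseteq> s} = {s}" by (rule card_1_singletonE)
    then have "s \<in> H" "e0 \<subseteq> s" "w s = v" unfolding v_def by (blast, blast, simp)
    then show ?thesis using ab(1) by (auto simp: K_def)
  qed
  then have "card {s \<in> K. {a, b} \<subseteq> s} \<noteq> 0" using finK by simp
  moreover have "card {s \<in> K. {a, b} \<subseteq> s} = card {s \<in> K. {a, c} \<subseteq> s}"
    using parity[of a b c] ab abc by blast
  moreover have "card {s \<in> K. {b, a} \<subseteq> s} = card {s \<in> K. {b, c} \<subseteq> s}"
    using parity[of b a c] ab abc by blast
  ultimately have "card {s \<in> K. e \<subseteq> s} \<noteq> 0" if "e \<in> B" for e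
    using that unfolding B_eq insert_commute[of b a] by (elim insertE emptyE) simp_all
  then have covered: "{s \<in> K. e \<subseteq> s} \<noteq> {}" if "e \<in> B" for e
    using that by (metis card.empty)
  have "\<exists>s. {s \<in> K. e \<subseteq> s} = {s} \<and> {s \<in> H. e \<subseteq> s} = {s}" if "e \<in> B" for e
    using single[of e] covered[OF that] that unfolding B_def by blast
  then obtain t where t: "\<And>e. e \<in> B \<Longrightarrow> {s \<in> K. e \<subseteq> s} = {t e} \<and> {s \<in> H. e \<subseteq> s} = {t e}"
    by metis
  then have c_t: "?c e = w (t e)" if "e \<in> B" for e using that by simp
  have t_val: "w (t e) = v \<or> w (t e) = 1 - v" if "e \<in> B" for e
    using t[OF that] by (auto simp: K_def)
  have "w (t e) = v" if e: "e \<in> B" for e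
  proof (cases "v = 1 - v")
    case True
    then show ?thesis using t_val[OF e] by metis
  next
    case False
    \<comment> \<open>For \<open>v\<close> different from 1/2 the two weights in \<open>K\<close>
      can be told apart by a sign. The two triangles at an inner edge have opposite signs and
      cancel, which leaves only the boundary edges.\<close>
    let ?\<sigma> = "\<lambda>s. if w s = v then 1 else - 1 :: int"
    have "(\<Sum>s\<in>K. ?\<sigma> s * int (card {e \<in> F. e \<subseteq> s})) = (\<Sum>e\<in>F. \<Sum>s\<in>{s\<in>K. e \<subseteq> s}. ?\<sigma> s)"
      using finF finK by (rule sum_incidence_swap)
    also have "\<dots> = (\<Sum>e\<in>B. \<Sum>s\<in>{s\<in>K. e \<subseteq> s}. ?\<sigma> s)"
    proof (rule sum.mono_neutral_right[OF finF B], rule ballI)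
      fix e assume "e \<in> F - B"
      then have e: "\<not> e \<subseteq> T" "card e = 2" by (auto simp: F_def B_def)
      show "(\<Sum>s\<in>{s\<in>K. e \<subseteq> s}. ?\<sigma> s) = 0"
      proof (cases "{s \<in> K. e \<subseteq> s} = {}")
        case False
        then obtain s s' where s: "{s \<in> K. e \<subseteq> s} = {s, s'}" "s \<noteq> s'" "w s' = 1 - w s"
          using pair[OF e] by blast
        moreover have "s \<in> K" using s(1) by blast
        ultimately show ?thesis using \<open>v \<noteq> 1 - v\<close> by (auto simp: K_def)
      qed (simp only: sum.empty)
    qed
    also have "\<dots> = (\<Sum>e\<in>B. ?\<sigma> (t e))" using t by (intro sum.cong) auto
    finally have "(\<Sum>s\<in>K. ?\<sigma> s * int (card {e \<in> F. e \<subseteq> s})) = (\<Sum>e\<in>B. ?\<sigma> (t e))" .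
    \<comment> \<open>Each triangle is counted once for each of its three edges. A sum of three
      signs is divisible by 3 only if they all agree, and the sign at \<open>{a, b}\<close> is
      positive.\<close>
    moreover have "3 dvd (\<Sum>s\<in>K. ?\<sigma> s * int (card {e \<in> F. e \<subseteq> s}))"
    proof (rule dvd_sum)
      fix s assume s: "s \<in> K"
      then have "card s = 3" using H(2) by (simp add: K_def)
      moreover from this have "finite s" by (intro card_ge_0_finite) simp
      moreover have "{e \<in> F. e \<subseteq> s} = {e. e \<subseteq> s \<and> card e = 2}" using s by (auto simp: F_def)
      ultimately have "card {e \<in> F. e \<subseteq> s} = 3" by (simp add: n_subsets choose_two)
      then show "3 dvd ?\<sigma> s * int (card {e \<in> F. e \<subseteq> s})" by simp
    qed
    ultimately have "3 dvd (\<Sum>e\<in>B. ?\<sigma> (t e))" by simp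
    moreover have "{a, b} \<noteq> {a, c}" "{a, b} \<noteq> {b, c}" "{a, c} \<noteq> {b, c}"
      using ab abc by (auto simp: doubleton_eq_iff)
    ultimately have "3 dvd ?\<sigma> (t {a, b}) + ?\<sigma> (t {a, c}) + ?\<sigma> (t {b, c})"
      unfolding B_eq by (simp add: add.assoc)
    moreover have "w (t {a, b}) = v" using c_t[of "{a, b}"] ab unfolding B_eq v_def by simp
    ultimately have "w (t {a, c}) = v" "w (t {b, c}) = v" by (auto split: if_splits)
    with \<open>w (t {a, b}) = v\<close> show ?thesis using e unfolding B_eq by auto
  qed
  then show "\<exists>x. \<forall>e. e \<subseteq> T \<and> card e = 2 \<longrightarrow> ?c e = x"
    using c_t by (intro exI[of _ v]) (simp add: B_def)
qed

section \<open>Theta curves\<close>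

lemma connected_subset_inside:
  assumes "connected T" "T \<inter> S = {}" "x \<in> T" "x \<in> inside S"
  shows "T \<subseteq> inside S"
proof
  fix y assume "y \<in> T"
  have "y \<notin> S" using \<open>y \<in> T\<close> assms(2) by blast
  moreover have "y \<notin> outside S"
    using inside_outside_intersect_connected[OF assms(1), of S] assms \<open>y \<in> T\<close> by blast
  ultimately show "y \<in> inside S" by (simp add: inside_outside)
qed

text \<open>Arcs are handled as point sets with named ends, so that the direction of a
  parametrization is irrelevant.\<close>

definition arc_between :: "complex set \<Rightarrow> complex \<Rightarrow> complex \<Rightarrow> bool" where
  "arc_between S a b \<longleftrightarrow> (\<exists>h. arc h \<and> pathstart h = a \<and> pathfinish h = b \<and> path_image h = S)"

lemma arc_between_commute: "arc_between S a b \<longleftrightarrow> arc_between S b a"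
  unfolding arc_between_def
  by (metis arc_reversepath path_image_reversepath pathfinish_reversepath pathstart_reversepath)

lemma arc_between_distinct: "arc_between S a b \<Longrightarrow> a \<noteq> b"
  unfolding arc_between_def using arc_distinct_ends by blast

lemma arc_between_ends: "arc_between S a b \<Longrightarrow> a \<in> S \<and> b \<in> S"
  unfolding arc_between_def by auto

lemma arc_between_compact: "arc_between S a b \<Longrightarrow> compact S"
  unfolding arc_between_def using compact_arc_image by blast

lemma arc_between_connected: "arc_between S a b \<Longrightarrow> connected S"
  unfolding arc_between_def using connected_arc_image by blast

lemma arc_between_connected_interior: "arc_between S a b \<Longrightarrow> connected (S - {a, b})"
  unfolding arc_between_def using connected_simple_path_endless arc_imp_simple_path by blast

lemma arc_between_connected_half_open:
  assumes "arc_between S a b"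
  shows "connected (S - {b})"
proof -
  obtain h where h: "arc h" "pathstart h = a" "pathfinish h = b" "path_image h = S"
    using assms unfolding arc_between_def by blast
  have inj: "inj_on h {0..1}" and cont: "continuous_on {0..1} h"
    using h(1) by (auto simp: arc_def path_def)
  have "h ` ({0..1} - {1}) = h ` {0..1} - h ` {1}"
    using inj by (intro inj_on_image_set_diff) auto
  then have "S - {b} = h ` ({0..1} - {1})" using h by (simp add: path_image_def pathfinish_def)
  also have "{0..1} - {1} = {0..<1::real}" by auto
  finally have "S - {b} = h ` {0..<1}" .
  moreover have "connected (h ` {0..<1})"
    by (rule connected_continuous_image[OF continuous_on_subset[OF cont]]) auto
  ultimately show ?thesis by simp
qed

lemma arc_between_interior_nonempty: "arc_between S a b \<Longrightarrow> S - {a, b} \<noteq> {}"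
  unfolding arc_between_def using nonempty_simple_path_endless arc_imp_simple_path by blast

lemma arc_between_join:
  assumes "arc_between S a b" "arc_between T b c" "S \<inter> T \<subseteq> {b}"
  shows "arc_between (S \<union> T) a c"
proof -
  obtain h k where h: "arc h" "pathstart h = a" "pathfinish h = b" "path_image h = S"
    and k: "arc k" "pathstart k = b" "pathfinish k = c" "path_image k = T"
    using assms unfolding arc_between_def by blast
  have "arc (h +++ k)" using h k assms(3) by (intro arc_join) auto
  with h k show ?thesis unfolding arc_between_def
    by (metis path_image_join pathfinish_join pathstart_join)
qed

lemma two_arcs_loop:
  assumes "arc_between S a b" "arc_between T a b" "S \<inter> T = {a, b}"
  obtains c where "simple_path c" "pathfinish c = pathstart c" "path_image c = S \<union> T"
proof -
  obtain h k where h: "arc h" "pathstart h = a" "pathfinish h = b" "path_image h = S"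
    and k: "arc k" "pathstart k = b" "pathfinish k = a" "path_image k = T"
    using assms(1) assms(2)[THEN arc_between_commute[THEN iffD1]] unfolding arc_between_def by blast
  have "simple_path (h +++ k)" using h k assms(3) by (intro simple_path_join_loop) auto
  with h k that[of "h +++ k"] show ?thesis by (simp add: path_image_join)
qed

lemma loop_frontier_outside:
  assumes "arc_between S a b" "arc_between T a b" "S \<inter> T = {a, b}"
  shows "frontier (outside (S \<union> T)) = S \<union> T"
proof -
  obtain c where "simple_path c" "pathfinish c = pathstart c" "path_image c = S \<union> T"
    using two_arcs_loop assms by metis
  then show ?thesis using Jordan_inside_outside[of c] by auto
qed

text \<open>The outside of \<open>S\<close> is connected, unbounded and disjoint from
  \<open>T\<close>, so it cannot meet the bounded set \<open>inside T\<close>. Points of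
  \<open>S\<close> are limits of outside points, and \<open>inside T\<close> is open, so it avoids
  \<open>S\<close> as well.\<close>

lemma inside_subset_inside:
  fixes S T :: "'a::euclidean_space set"
  assumes "compact S" "compact T" "2 \<le> DIM('a)" "frontier (outside S) = S"
    and "T \<inter> outside S = {}"
  shows "inside T \<subseteq> inside S"
proof -
  have disj: "inside T \<inter> outside S = {}"
  proof (rule ccontr)
    assume "inside T \<inter> outside S \<noteq> {}"
    then obtain x where x: "x \<in> inside T" "x \<in> outside S" by blast
    have "connected (outside S)" using assms by (simp add: connected_outside compact_imp_bounded)
    moreover have "outside T \<inter> outside S \<noteq> {}"
    proof
      assume "outside T \<inter> outside S = {}"
      then have "outside S \<subseteq> inside T" using assms(5) by (auto simp: inside_outside)
      moreover have "bounded (inside T)"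
        using assms by (simp add: bounded_inside compact_imp_bounded)
      moreover have "\<not> bounded (outside S)"
        using assms(1,3) by (metis cobounded_imp_unbounded cobounded_outside compact_imp_bounded)
      ultimately show False using bounded_subset by blast
    qed
    ultimately have "T \<inter> outside S \<noteq> {}"
      using inside_outside_intersect_connected[of "outside S" T] x by blast
    then show False using assms(5) by blast
  qed
  have "open (inside T)" using assms(2) by (simp add: open_inside compact_imp_closed)
  then have "inside T \<inter> closure (outside S) = {}" using disj by (simp add: open_Int_closure_eq_empty)
  then have "inside T \<inter> S = {}" using assms(4) by (auto simp: frontier_def)
  with disj show ?thesis by (auto simp: inside_outside)
qed

section \<open>Relative position of three arcs with common ends\<close>

definition theta :: "complex \<Rightarrow> complex \<Rightarrow> complex set \<Rightarrow> complex set \<Rightarrow> complex set \<Rightarrow> bool" where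
  "theta a b A B C \<longleftrightarrow> arc_between A a b \<and> arc_between B a b \<and> arc_between C a b \<and>
     A \<inter> B = {a, b} \<and> A \<inter> C = {a, b} \<and> B \<inter> C = {a, b}"

lemma theta_rotate: "theta a b A B C \<Longrightarrow> theta a b B C A"
  and theta_swap: "theta a b A B C \<Longrightarrow> theta a b B A C"
  unfolding theta_def by blast+

lemma theta_interior_nonempty: "theta a b A B C \<Longrightarrow> A - {a, b} \<noteq> {}"
  unfolding theta_def using arc_between_interior_nonempty by blast

text \<open>Janiszewski's theorem: the loops \<open>A \<union> B\<close> and
  \<open>B \<union> C\<close> meet in the connected set \<open>B\<close>. If neither separates
  \<open>p\<close> from a point \<open>q\<close> far out, then neither does their union, and still
  less \<open>A \<union> C\<close>.\<close>

lemma theta_outside: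
  assumes "theta a b A B C" "p \<notin> A \<union> B \<union> C" "p \<notin> inside (A \<union> B)" "p \<notin> inside (B \<union> C)"
  shows "p \<notin> inside (A \<union> C)"
proof -
  have cpt: "compact A" "compact B" "compact C" and con: "connected B"
    and int: "(A \<union> B) \<inter> (B \<union> C) = B"
    using assms(1) arc_between_compact arc_between_connected arc_between_ends
    unfolding theta_def by blast+
  have "bounded (A \<union> B \<union> C)" using cpt by (simp add: compact_imp_bounded)
  then obtain q where q: "q \<in> outside (A \<union> B \<union> C)"
    using outside_bounded_nonempty by blast
  have cc: "connected_component (- S) q p" if "compact S" "S \<subseteq> A \<union> B \<union> C" "p \<notin> inside S" for S
  proof (rule connected_componentI)
    show "connected (outside S)" using that(1) by (simp add: connected_outside compact_imp_bounded)
    show "outside S \<subseteq> - S" using outside_no_overlap by blast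
    show "q \<in> outside S" using outside_mono[OF that(2)] q by blast
    show "p \<in> outside S" using that assms(2) by (auto simp: outside_inside)
  qed
  have "connected_component (- ((A \<union> B) \<union> (B \<union> C))) q p"
    using cpt con int assms(3,4)
    by (intro Janiszewski cc) (auto simp: compact_imp_closed closed_Un compact_Un)
  moreover have "(A \<union> B) \<union> (B \<union> C) = A \<union> B \<union> C" by blast
  ultimately have "p \<in> outside (A \<union> B \<union> C)" using outside_same_component q by metis
  then have "p \<in> outside (A \<union> C)" using outside_mono[of "A \<union> C" "A \<union> B \<union> C"] by blast
  then show ?thesis by (metis disjoint_iff inside_Int_outside)
qed

lemma theta_loop:
  assumes "theta a b A B C"
  shows "inside (A \<union> B) \<noteq> {}" "connected (inside (A \<union> B))" "frontier (inside (A \<union> B)) = A \<union> B"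
proof -
  obtain c where "simple_path c" "pathfinish c = pathstart c" "path_image c = A \<union> B"
    using two_arcs_loop assms unfolding theta_def by metis
  then show "inside (A \<union> B) \<noteq> {}" "connected (inside (A \<union> B))" "frontier (inside (A \<union> B)) = A \<union> B"
    using Jordan_inside_outside[of c] by auto
qed

lemma inside_disjoint: "inside S \<inter> S = {}"
  using inside_no_overlap by blast

lemma theta_interior_inside:
  assumes "theta a b A B C" "x \<in> C" "x \<in> inside (A \<union> B)"
  shows "C - {a, b} \<subseteq> inside (A \<union> B)"
proof (rule connected_subset_inside)
  show "connected (C - {a, b})" using assms(1) arc_between_connected_interior unfolding theta_def by blast
  show "(C - {a, b}) \<inter> (A \<union> B) = {}" using assms(1) unfolding theta_def by blast
  show "x \<in> C - {a, b}" using assms inside_disjoint[of "A \<union> B"] unfolding theta_def by blast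
qed fact

text \<open>If no arc were inside the loop of the other two, the insides of the three loops would be
  three distinct bounded faces, and a point of one of them contradicts \<open>theta_outside\<close>.\<close>

lemma theta_inside:
  assumes th: "theta a b A B C" and A: "A \<inter> inside (B \<union> C) = {}" and B: "B \<inter> inside (A \<union> C) = {}"
  shows "C - {a, b} \<subseteq> inside (A \<union> B)"
proof -
  have thAC: "theta a b A C B" and thBC: "theta a b B C A"
    using th unfolding theta_def by blast+
  note AC = theta_loop[OF thAC] and AB = theta_loop[OF th] and BC = theta_loop[OF thBC]
  obtain p where p: "p \<in> inside (A \<union> C)" using AC(1) by blast
  have X: "inside (A \<union> C) \<inter> (A \<union> B \<union> C) = {}" using inside_disjoint B by blast
  have "C \<inter> inside (A \<union> B) \<noteq> {}"
  proof
    assume C: "C \<inter> inside (A \<union> B) = {}"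
    \<comment> \<open>Otherwise \<open>theta_outside\<close> would exclude \<open>p\<close> from
      \<open>inside (A \<union> C)\<close>.\<close>
    consider "p \<in> inside (A \<union> B)" | "p \<in> inside (B \<union> C)"
      using theta_outside[OF th, of p] p X by blast
    then show False
    proof cases
      case 1
      \<comment> \<open>Both insides are connected, contain \<open>p\<close> and miss the loop of
        the other, so they coincide. Equal frontiers would put the interior of \<open>B\<close> on
        \<open>A \<union> C\<close>.\<close>
      have "inside (A \<union> C) \<subseteq> inside (A \<union> B)"
        using connected_subset_inside[OF AC(2) _ p 1] X by blast
      moreover have "inside (A \<union> B) \<subseteq> inside (A \<union> C)"
        using connected_subset_inside[OF AB(2) _ 1 p] C inside_disjoint[of "A \<union> B"] by blast
      ultimately have "A \<union> B = A \<union> C" using AC(3) AB(3) by (metis subset_antisym)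
      then show False using th arc_between_interior_nonempty[of B a b] unfolding theta_def by blast
    next
      case 2
      have "inside (A \<union> C) \<subseteq> inside (B \<union> C)"
        using connected_subset_inside[OF AC(2) _ p 2] X by blast
      moreover have "inside (B \<union> C) \<subseteq> inside (A \<union> C)"
        using connected_subset_inside[OF BC(2) _ 2 p] A inside_disjoint[of "B \<union> C"] by blast
      ultimately have "B \<union> C = A \<union> C" using AC(3) BC(3) by (metis subset_antisym)
      then show False using th arc_between_interior_nonempty[of B a b] unfolding theta_def by blast
    qed
  qed
  then show ?thesis using theta_interior_inside[OF th] by blast
qed

lemma theta_split:
  assumes "theta a b A B C" "C \<inter> inside (A \<union> B) \<noteq> {}"
  shows "inside (A \<union> C) \<inter> inside (B \<union> C) = {}"
    and "inside (A \<union> C) \<union> inside (B \<union> C) \<union> (C - {a, b}) = inside (A \<union> B)"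
proof -
  obtain h k l where "arc h" "pathstart h = a" "pathfinish h = b" "path_image h = A"
    and "arc k" "pathstart k = a" "pathfinish k = b" "path_image k = B"
    and "arc l" "pathstart l = a" "pathfinish l = b" "path_image l = C"
    using assms(1) unfolding theta_def arc_between_def by blast
  moreover have "a \<noteq> b" using assms(1) arc_between_distinct unfolding theta_def by blast
  moreover have "A \<inter> B = {a, b}" "A \<inter> C = {a, b}" "B \<inter> C = {a, b}"
    using assms(1) unfolding theta_def by auto
  ultimately show "inside (A \<union> C) \<inter> inside (B \<union> C) = {}"
    "inside (A \<union> C) \<union> inside (B \<union> C) \<union> (C - {a, b}) = inside (A \<union> B)"
    using split_inside_simple_closed_curve[of h a b k l] assms(2) arc_imp_simple_path by metis+
qed

text \<open>An arc running inside the loop of the other two would separate two of the three insides,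
  by \<open>theta_split\<close>, although they share \<open>p\<close>. So no arc does, contrary to
  \<open>theta_inside\<close>.\<close>

lemma theta_not_inside_all:
  assumes "theta a b A B C" "p \<in> inside (A \<union> B)" "p \<in> inside (A \<union> C)" "p \<in> inside (B \<union> C)"
  shows False
proof -
  have split: "inside (X \<union> Z) \<inter> inside (Y \<union> Z) = {}"
    if "theta a b X Y Z" "Z \<inter> inside (X \<union> Y) \<noteq> {}" for X Y Z
    using theta_split that by blast
  have ths: "theta a b B C A" "theta a b A C B" using assms(1) unfolding theta_def by blast+
  have "A \<inter> inside (B \<union> C) = {}" "B \<inter> inside (A \<union> C) = {}" "C \<inter> inside (A \<union> B) = {}"
    using split[OF ths(1)] split[OF ths(2)] split[OF assms(1)] assms(2-4)
    by (auto simp: Un_commute)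
  moreover have "C - {a, b} \<noteq> {}"
    using assms(1) arc_between_interior_nonempty unfolding theta_def by blast
  ultimately show False using theta_inside[OF assms(1)] by blast
qed

text \<open>Here \<open>E\<close> is an edge and \<open>A\<close>, \<open>B\<close>,
  \<open>C\<close> complete it to three closed curves. If no completing arc enters another of these
  curves, \<open>theta_inside\<close> puts \<open>E\<close> inside the loop of each two of them, and
  \<open>theta_not_inside_all\<close> forbids that.\<close>

lemma no_three_pages:
  assumes th: "theta a b E A B" "theta a b E A C" "theta a b E B C" "theta a b A B C"
    and out: "B \<inter> inside (E \<union> A) = {}" "C \<inter> inside (E \<union> A) = {}" "A \<inter> inside (E \<union> B) = {}"
      "C \<inter> inside (E \<union> B) = {}" "A \<inter> inside (E \<union> C) = {}" "B \<inter> inside (E \<union> C) = {}"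
  shows False
proof -
  obtain p where p: "p \<in> E - {a, b}" using theta_interior_nonempty[OF th(1)] by blast
  have "E - {a, b} \<subseteq> inside (A \<union> B)" "E - {a, b} \<subseteq> inside (A \<union> C)" "E - {a, b} \<subseteq> inside (B \<union> C)"
    using theta_inside[OF theta_rotate[OF th(1)]] theta_inside[OF theta_rotate[OF th(2)]]
      theta_inside[OF theta_rotate[OF th(3)]] out
    by (metis Un_commute)+
  then show False using theta_not_inside_all[OF th(4), of p] p by blast
qed

text \<open>As neither of \<open>B\<close> and \<open>C\<close> enters the other's curve,
  \<open>E\<close> runs inside \<open>B \<union> C\<close>. But \<open>E\<close> is on the boundary
  of \<open>inside (E \<union> A)\<close>, which contains the insides of \<open>A \<union> B\<close>
  and \<open>A \<union> C\<close>; by \<open>theta_outside\<close> a point of \<open>E\<close> is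
  then not inside \<open>B \<union> C\<close>.\<close>

lemma no_two_inner_pages:
  assumes th: "theta a b E A B" "theta a b E A C" "theta a b E B C" "theta a b A B C"
    and ins: "B \<inter> inside (E \<union> A) \<noteq> {}" "C \<inter> inside (E \<union> A) \<noteq> {}"
    and out: "C \<inter> inside (E \<union> B) = {}" "B \<inter> inside (E \<union> C) = {}"
  shows False
proof -
  obtain p where p: "p \<in> E - {a, b}" using theta_interior_nonempty[OF th(1)] by blast
  have "p \<in> inside (B \<union> C)"
    using theta_inside[OF theta_rotate[OF th(3)]] out p by (metis Un_commute subsetD)
  moreover have "p \<notin> inside (E \<union> A)" using p inside_disjoint by blast
  then have "p \<notin> inside (A \<union> B)" "p \<notin> inside (A \<union> C)"
    using theta_split(2)[OF th(1) ins(1)] theta_split(2)[OF th(2) ins(2)] by blast+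
  moreover have "theta a b B A C" using th(4) theta_swap by blast
  moreover have "E \<inter> (B \<union> A \<union> C) = {a, b}"
    using th(1,2) unfolding theta_def by (simp add: Int_Un_distrib)
  then have "p \<notin> B \<union> A \<union> C" using p by blast
  ultimately show False using theta_outside[of a b B A C p] by (metis Un_commute)
qed

section \<open>Triangles of a plane graph\<close>

lemma triangle_edge:
  assumes "t \<in> triangles V E" "u \<in> t" "v \<in> t" "u \<noteq> v"
  shows "{u, v} \<in> E"
  using assms unfolding triangles_def by blast

lemma triangle_vertices:
  assumes "t \<in> triangles V E" "{u, v} \<subseteq> t" "u \<noteq> v"
  obtains x where "t = {u, v, x}" "x \<noteq> u" "x \<noteq> v"
proof -
  have "card t = 3" using assms(1) by (simp add: triangles_def)
  then have "card (t - {u, v}) = 1" using assms(2,3) by (simp add: card_Diff_subset)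
  then obtain x where "t - {u, v} = {x}" by (rule card_1_singletonE)
  with that[of x] assms(2) show ?thesis by blast
qed

section \<open>Drawn triangles and the vertices inside them\<close>

locale plane_graph =
  fixes V :: "'a set" and E :: "'a set set" and p g
  assumes simple: "simple_graph V E" and drawing: "plane_drawing V E p g"
begin

definition curve :: "'a set \<Rightarrow> complex set" where
  "curve t = (\<Union>e\<in>{e \<in> E. e \<subseteq> t}. path_image (g e))"

definition inner :: "'a set \<Rightarrow> 'a set" where
  "inner t = {v \<in> V. p v \<in> inside (curve t)}"

abbreviation im :: "'a set \<Rightarrow> complex set" where "im e \<equiv> path_image (g e)"

lemma edge_subset: "e \<in> E \<Longrightarrow> e \<subseteq> V" and card_edge: "e \<in> E \<Longrightarrow> card e = 2"
  using simple unfolding simple_graph_def by blast+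

lemma p_eq_iff: "u \<in> V \<Longrightarrow> v \<in> V \<Longrightarrow> p u = p v \<longleftrightarrow> u = v"
  using drawing unfolding plane_drawing_def by (meson inj_onD)

lemma edge_ends: "e \<in> E \<Longrightarrow> {pathstart (g e), pathfinish (g e)} = p ` e"
  and edge_arc: "e \<in> E \<Longrightarrow> arc (g e)"
  using drawing by (simp_all add: plane_drawing_def)

lemma arc_between_edge:
  assumes "{u, v} \<in> E"
  shows "arc_between (im {u, v}) (p u) (p v)"
proof -
  have "arc_between (im {u, v}) (pathstart (g {u, v})) (pathfinish (g {u, v}))"
    using edge_arc[OF assms] unfolding arc_between_def by blast
  moreover have "{pathstart (g {u, v}), pathfinish (g {u, v})} = {p u, p v}"
    using edge_ends[OF assms] by simp
  ultimately show ?thesis by (metis arc_between_commute doubleton_eq_iff)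
qed

lemma vertex_on_edge: "e \<in> E \<Longrightarrow> v \<in> V \<Longrightarrow> p v \<in> im e \<longleftrightarrow> v \<in> e"
proof -
  assume e: "e \<in> E" and v: "v \<in> V"
  have "p ` e \<subseteq> im e"
    using edge_ends[OF e] pathstart_in_path_image pathfinish_in_path_image by (metis insert_subset empty_subsetI)
  moreover have "(im e - p ` e) \<inter> p ` V = {}"
    using drawing e edge_ends[OF e] unfolding plane_drawing_def arc_interior_def by metis
  ultimately show ?thesis using v edge_subset[OF e] p_eq_iff by blast
qed

lemma edge_Int_edge:
  assumes "e \<in> E" "f \<in> E" "e \<noteq> f"
  shows "im e \<inter> im f = p ` (e \<inter> f)"
proof
  have "(im e - p ` e) \<inter> im f = {}" "(im f - p ` f) \<inter> im e = {}"
    using drawing assms edge_ends unfolding plane_drawing_def arc_interior_def by metis+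
  then have "im e \<inter> im f \<subseteq> p ` e \<inter> p ` f" by blast
  also have "\<dots> = p ` (e \<inter> f)"
    using drawing edge_subset assms unfolding plane_drawing_def by (metis inj_on_image_Int)
  finally show "im e \<inter> im f \<subseteq> p ` (e \<inter> f)" .
  show "p ` (e \<inter> f) \<subseteq> im e \<inter> im f"
    using vertex_on_edge edge_subset assms by blast
qed

lemma compact_curve: "t \<in> triangles V E \<Longrightarrow> compact (curve t)"
proof -
  assume t: "t \<in> triangles V E"
  have "finite t" using t by (intro card_ge_0_finite) (simp add: triangles_def)
  then have "finite {e \<in> E. e \<subseteq> t}" by simp
  then show ?thesis unfolding curve_def
    by (rule compact_UN) (use edge_arc compact_arc_image in blast)
qed

lemma edge_subset_curve: "e \<in> E \<Longrightarrow> e \<subseteq> t \<Longrightarrow> im e \<subseteq> curve t"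
  unfolding curve_def by blast

lemma vertex_on_curve:
  assumes "t \<in> triangles V E" "v \<in> V"
  shows "p v \<in> curve t \<longleftrightarrow> v \<in> t"
proof
  assume "p v \<in> curve t"
  then show "v \<in> t" using assms vertex_on_edge unfolding curve_def by blast
next
  assume "v \<in> t"
  have "card t = 3" using assms by (simp add: triangles_def)
  then have "card (t - {v}) = 2" using \<open>v \<in> t\<close> by (simp add: card_Diff_singleton)
  then obtain u where "u \<in> t" "u \<noteq> v" by (auto simp: card_2_iff)
  then have "{v, u} \<in> E" "{v, u} \<subseteq> t" using assms \<open>v \<in> t\<close> triangle_edge by (metis, blast)
  then show "p v \<in> curve t" using edge_subset_curve vertex_on_edge[of "{v, u}" v] assms(2) by blast
qed

lemma inner_disjoint: "t \<in> triangles V E \<Longrightarrow> inner t \<inter> t = {}"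
  using vertex_on_curve[of t] inside_disjoint[of "curve t"] unfolding inner_def by blast

lemma edge_Int_curve:
  assumes "t \<in> triangles V E" "e \<in> E" "\<not> e \<subseteq> t"
  shows "im e \<inter> curve t \<subseteq> p ` (e \<inter> t)"
proof
  fix x assume "x \<in> im e \<inter> curve t"
  then obtain f where f: "f \<in> E" "f \<subseteq> t" "x \<in> im e \<inter> im f" unfolding curve_def by blast
  then have "x \<in> p ` (e \<inter> f)" using edge_Int_edge[OF assms(2) f(1)] assms(3) by auto
  then show "x \<in> p ` (e \<inter> t)" using f(2) by blast
qed

text \<open>Without its possible end on \<open>t\<close> the arc is still connected, misses the
  curve and contains \<open>p u\<close>, so it cannot leave the inside.\<close>

lemma edge_from_inner:
  assumes "t \<in> triangles V E" "{u, v} \<in> E" "u \<in> inner t"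
  shows "im {u, v} - p ` t \<subseteq> inside (curve t)" and "v \<in> t \<union> inner t"
proof -
  have V: "u \<in> V" "v \<in> V" using edge_subset[OF assms(2)] by auto
  have tV: "t \<subseteq> V" using assms(1) by (simp add: triangles_def)
  have u: "u \<notin> t" using inner_disjoint[OF assms(1)] assms(3) by blast
  have pu: "p u \<in> im {u, v}" "p v \<in> im {u, v}" using vertex_on_edge[OF assms(2)] V by auto
  have p_notin: "p w \<notin> p ` t" if "w \<in> V" "w \<notin> t" for w
    using that tV p_eq_iff by (metis imageE subsetD)
  have disj: "(im {u, v} - p ` t) \<inter> curve t = {}" using edge_Int_curve[OF assms(1,2)] u by blast
  have "im {u, v} \<inter> p ` t = p ` ({u, v} \<inter> t)" using vertex_on_edge[OF assms(2)] tV by blast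
  then have "im {u, v} - p ` t = im {u, v} \<or> im {u, v} - p ` t = im {u, v} - {p v}" using u by auto
  then have "connected (im {u, v} - p ` t)"
    using arc_between_edge[OF assms(2)] arc_between_connected arc_between_connected_half_open by metis
  then show sub: "im {u, v} - p ` t \<subseteq> inside (curve t)"
    using connected_subset_inside[OF _ disj, of "p u"] pu p_notin[OF V(1) u] assms(3)
    by (simp add: inner_def)
  show "v \<in> t \<union> inner t"
    using sub pu(2) V(2) p_notin[OF V(2)] unfolding inner_def by blast
qed

text \<open>The triangles on an edge \<open>{a, b}\<close> form a book with that edge as spine; a
  page is the path through the third vertex \<open>c\<close>.\<close>

definition page :: "'a \<Rightarrow> 'a \<Rightarrow> 'a \<Rightarrow> complex set" where
  "page a b c = im {a, c} \<union> im {c, b}"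

lemma triangle_edges:
  assumes "{a, b, c} \<in> triangles V E"
  shows "{a, b} \<in> E" "{a, c} \<in> E" "{c, b} \<in> E" "a \<noteq> b" "a \<noteq> c" "c \<noteq> b"
    "a \<in> V" "b \<in> V" "c \<in> V"
proof -
  have "card {a, b, c} = 3" using assms by (simp add: triangles_def)
  then show ne: "a \<noteq> b" "a \<noteq> c" "c \<noteq> b" by (auto simp: card_insert_if split: if_splits)
  show "{a, b} \<in> E" "{a, c} \<in> E" "{c, b} \<in> E"
    using assms ne by (auto intro!: triangle_edge[OF assms])
  show "a \<in> V" "b \<in> V" "c \<in> V" using assms by (auto simp: triangles_def)
qed

lemma arc_between_page:
  assumes "{a, b, c} \<in> triangles V E"
  shows "arc_between (page a b c) (p a) (p b)"
proof -
  note t = triangle_edges[OF assms]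
  have "{a, c} \<noteq> {c, b}" "{a, c} \<inter> {c, b} = {c}" using t by auto
  then have "im {a, c} \<inter> im {c, b} = {p c}" using edge_Int_edge t by simp
  then show ?thesis unfolding page_def using arc_between_join arc_between_edge t by blast
qed

lemma edge_Int_page:
  assumes "{a, b, c} \<in> triangles V E"
  shows "im {a, b} \<inter> page a b c = {p a, p b}"
proof -
  note t = triangle_edges[OF assms]
  have "{a, b} \<inter> {a, c} = {a}" "{a, b} \<inter> {c, b} = {b}" "{a, b} \<noteq> {a, c}" "{a, b} \<noteq> {c, b}"
    using t by auto
  then show ?thesis unfolding page_def using edge_Int_edge t
    by (simp add: Int_Un_distrib insert_commute)
qed

lemma page_Int_page:
  assumes "{a, b, c} \<in> triangles V E" "{a, b, d} \<in> triangles V E" "c \<noteq> d"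
  shows "page a b c \<inter> page a b d = {p a, p b}"
proof -
  note t = triangle_edges[OF assms(1)] triangle_edges[OF assms(2)]
  have "{a, c} \<inter> {a, d} = {a}" "{c, b} \<inter> {d, b} = {b}" "{a, c} \<inter> {d, b} = {}" "{c, b} \<inter> {a, d} = {}"
    "{a, c} \<noteq> {a, d}" "{c, b} \<noteq> {d, b}" "{a, c} \<noteq> {d, b}" "{c, b} \<noteq> {a, d}"
    using t assms(3) by auto
  then show ?thesis unfolding page_def using edge_Int_edge t
    by (simp add: Int_Un_distrib Int_Un_distrib2 insert_commute)
qed

lemma curve_eq:
  assumes "{a, b, c} \<in> triangles V E"
  shows "curve {a, b, c} = im {a, b} \<union> page a b c"
proof -
  note t = triangle_edges[OF assms]
  have "e \<in> {{a, b}, {a, c}, {c, b}}" if e: "e \<in> E" "e \<subseteq> {a, b, c}" for e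
  proof -
    obtain u v where "e = {u, v}" "u \<noteq> v" using card_edge[OF e(1)] card_2_iff by metis
    with e(2) show ?thesis by (auto simp: insert_commute)
  qed
  then have "{e \<in> E. e \<subseteq> {a, b, c}} = {{a, b}, {a, c}, {c, b}}" using t by auto
  then show ?thesis unfolding curve_def page_def by (simp add: Un_assoc)
qed

lemma theta_triangles:
  assumes "{a, b, c} \<in> triangles V E" "{a, b, d} \<in> triangles V E" "c \<noteq> d"
  shows "theta (p a) (p b) (im {a, b}) (page a b c) (page a b d)"
  unfolding theta_def
  using arc_between_page edge_Int_page page_Int_page arc_between_edge triangle_edges(1) assms by metis

lemma theta_pages:
  assumes "{a, b, c} \<in> triangles V E" "{a, b, d} \<in> triangles V E" "{a, b, f} \<in> triangles V E"
    and "c \<noteq> d" "c \<noteq> f" "d \<noteq> f"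
  shows "theta (p a) (p b) (page a b c) (page a b d) (page a b f)"
  unfolding theta_def using arc_between_page page_Int_page assms by metis

text \<open>Off its ends a page is connected and misses the other curve, so its position is decided
  by the vertex \<open>d\<close>. This turns the hypotheses on arcs into statements about
  \<open>inner\<close>.\<close>

lemma page_disjoint_inside:
  assumes "{a, b, c} \<in> triangles V E" "{a, b, d} \<in> triangles V E" "c \<noteq> d"
  shows "page a b d \<inter> inside (im {a, b} \<union> page a b c) = {} \<longleftrightarrow> d \<notin> inner {a, b, c}"
proof -
  note t = triangle_edges[OF assms(2)]
  have d: "p d \<in> page a b d" "p d \<notin> {p a, p b}"
    using vertex_on_edge[of "{a, d}" d] t p_eq_iff by (auto simp: page_def)
  have inner: "d \<in> inner {a, b, c} \<longleftrightarrow> p d \<in> inside (im {a, b} \<union> page a b c)"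
    using t unfolding inner_def curve_eq[OF assms(1)] by blast
  show ?thesis
  proof (cases "page a b d \<inter> inside (im {a, b} \<union> page a b c) = {}")
    case True
    then show ?thesis using d(1) inner by blast
  next
    case False
    then have "page a b d - {p a, p b} \<subseteq> inside (im {a, b} \<union> page a b c)"
      using theta_interior_inside[OF theta_triangles[OF assms]] by blast
    then show ?thesis using False d inner by blast
  qed
qed

lemma no_three_empty_triangles:
  assumes "{a, b, c} \<in> triangles V E" "{a, b, d} \<in> triangles V E" "{a, b, f} \<in> triangles V E"
    and "c \<noteq> d" "c \<noteq> f" "d \<noteq> f"
    and "inner {a, b, c} = {}" "inner {a, b, d} = {}" "inner {a, b, f} = {}"
  shows False
  by (rule no_three_pages[of "p a" "p b" "im {a, b}" "page a b c" "page a b d" "page a b f"])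
    (use assms assms(4-6)[symmetric] in \<open>simp_all add: theta_triangles theta_pages page_disjoint_inside\<close>)

lemma no_two_empty_inner_triangles:
  assumes "{a, b, c} \<in> triangles V E" "{a, b, d} \<in> triangles V E" "{a, b, f} \<in> triangles V E"
    and "d \<noteq> f" "d \<in> inner {a, b, c}" "f \<in> inner {a, b, c}"
    and "inner {a, b, d} = {}" "inner {a, b, f} = {}"
  shows False
proof -
  have "d \<notin> {a, b, c}" "f \<notin> {a, b, c}" using assms(5,6) inner_disjoint[OF assms(1)] by blast+
  then have ne: "c \<noteq> d" "c \<noteq> f" by auto
  show False
    by (rule no_two_inner_pages[of "p a" "p b" "im {a, b}" "page a b c" "page a b d" "page a b f"])
      (use assms assms(4)[symmetric] ne in
        \<open>simp_all add: theta_triangles theta_pages page_disjoint_inside\<close>)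
qed

text \<open>Every edge of \<open>t\<close> is an edge of \<open>T\<close> or has an end inside
  \<open>T\<close>, so no part of the curve of \<open>t\<close> is outside that of \<open>T\<close>.
  The Jordan curve theorem supplies the frontier condition of
  \<open>inside_subset_inside\<close>.\<close>

lemma inner_mono:
  assumes t: "t \<in> triangles V E" and T: "T \<in> triangles V E" and sub: "t \<subseteq> T \<union> inner T"
  shows "inner t \<subseteq> inner T"
proof -
  have out: "im f \<inter> outside (curve T) = {}" if f: "f \<in> E" "f \<subseteq> t" for f
  proof (cases "f \<subseteq> T")
    case True
    then show ?thesis using f edge_subset_curve outside_no_overlap by blast
  next
    case False
    then obtain u where u: "u \<in> f" "u \<in> inner T" using f sub by blast
    obtain v where v: "f = {u, v}" using card_two_other[OF card_edge[OF f(1)] u(1)] by metis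
    have "im f - p ` T \<subseteq> inside (curve T)" using edge_from_inner(1)[OF T] f u v by blast
    moreover have "p ` T \<subseteq> curve T" using vertex_on_curve[OF T] T by (auto simp: triangles_def)
    ultimately have "im f \<subseteq> curve T \<union> inside (curve T)" by blast
    then show ?thesis using union_with_inside[of "curve T"] by blast
  qed
  have "card T = 3" using T by (simp add: triangles_def)
  then obtain a b c where T_eq: "T = {a, b, c}" by (auto simp: card_3_iff)
  have "frontier (outside (curve T)) = curve T"
    using loop_frontier_outside[OF arc_between_edge arc_between_page edge_Int_page] T triangle_edges(1)
    unfolding T_eq by (simp add: curve_eq)
  moreover have "curve t \<inter> outside (curve T) = {}" using out unfolding curve_def[of t] by blast
  ultimately have "inside (curve t) \<subseteq> inside (curve T)"
    using inside_subset_inside compact_curve t T by (metis DIM_complex order_refl)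
  then show ?thesis unfolding inner_def by blast
qed

end

section \<open>Removing the inside of an innermost triangle\<close>

text \<open>Integrality of \<open>2 * w' t\<close> suffices, because in a simple graph a
  decomposition has all its weights between 0 and 1.\<close>

definition half_rounding :: "'a set \<Rightarrow> 'a set set \<Rightarrow> ('a set \<Rightarrow> rat) \<Rightarrow> ('a set \<Rightarrow> rat) \<Rightarrow> bool" where
  "half_rounding V E w w' \<longleftrightarrow> rational_K3_decomposition V E w' \<and>
     (\<forall>t\<in>triangles V E. 2 * w' t \<in> \<int> \<and> floor2 (w t) \<le> w' t)"

lemma half_roundingI:
  assumes w: "\<And>t. t \<in> triangles V E \<Longrightarrow> 0 \<le> w t"
    and half: "\<And>t. t \<in> triangles V E \<Longrightarrow> 2 * w' t \<in> \<int>"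
    and lower: "\<And>t. t \<in> triangles V E \<Longrightarrow> floor2 (w t) \<le> w' t"
    and sum: "\<And>e. e \<in> E \<Longrightarrow> sum w' {t \<in> triangles V E. e \<subseteq> t} = 1"
  shows "half_rounding V E w w'"
  unfolding half_rounding_def rational_K3_decomposition_def
proof (intro conjI ballI)
  fix t assume t: "t \<in> triangles V E"
  show "0 \<le> w' t" using floor2_nonneg[OF w[OF t]] lower[OF t] by linarith
  show "2 * w' t \<in> \<int>" "floor2 (w t) \<le> w' t" using t half lower by blast+
qed (rule sum)

lemma plane_drawing_subgraph:
  assumes "plane_drawing V E p g" "V' \<subseteq> V" "E' \<subseteq> E"
  shows "plane_drawing V' E' p g"
proof -
  have inj: "inj_on p V'" using assms unfolding plane_drawing_def by (meson inj_on_subset)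
  have E: "e \<in> E" if "e \<in> E'" for e using assms(3) that by blast
  have V: "p ` V' \<subseteq> p ` V" using assms(2) by blast
  show ?thesis
    using assms(1) inj V unfolding plane_drawing_def
    by (intro conjI; simp add: E disjoint_iff subset_iff) (metis E)+
qed

lemma finite_triangles: "finite V \<Longrightarrow> finite (triangles V E)"
  unfolding triangles_def by (rule finite_subset[of _ "Pow V"]) auto

lemma decomposition_sum:
  "rational_K3_decomposition V E w \<Longrightarrow> e \<in> E \<Longrightarrow> sum w {t \<in> triangles V E. e \<subseteq> t} = 1"
  and decomposition_nonneg:
  "rational_K3_decomposition V E w \<Longrightarrow> t \<in> triangles V E \<Longrightarrow> 0 \<le> w t"
  unfolding rational_K3_decomposition_def by blast+

lemma decomposition_le_one:
  assumes "simple_graph V E" "rational_K3_decomposition V E w" "t \<in> triangles V E"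
  shows "0 \<le> w t \<and> w t \<le> 1"
proof -
  have "card t = 3" using assms(3) by (simp add: triangles_def)
  then obtain u v x where uv: "t = {u, v, x}" "u \<noteq> v" by (auto simp: card_3_iff)
  then have "{u, v} \<in> E" using triangle_edge[OF assms(3)] by simp
  then have "sum w {t \<in> triangles V E. {u, v} \<subseteq> t} = 1"
    using decomposition_sum[OF assms(2)] by blast
  moreover have "w t \<le> sum w {t \<in> triangles V E. {u, v} \<subseteq> t}"
    using assms uv finite_triangles[of V E] decomposition_nonneg[OF assms(2)]
    by (intro member_le_sum) (auto simp: simple_graph_def)
  ultimately show ?thesis using decomposition_nonneg[OF assms(2,3)] by simp
qed

section \<open>Triangles without inner vertices, and triangles inside a given one\<close>

context plane_graph
begin

lemma finite_tri: "finite (triangles V E)"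
  using simple finite_triangles unfolding simple_graph_def by blast

text \<open>\<open>S\<close> is kept general so that it can be all triangles at an edge or only
  those inside a fixed triangle.\<close>

lemma card_triangles_at_edge:
  assumes e: "e \<in> E" and S: "\<And>t. t \<in> S \<Longrightarrow> t \<in> triangles V E \<and> inner t = {} \<and> e \<subseteq> t"
  shows "card S \<le> 2"
proof (rule ccontr)
  assume "\<not> card S \<le> 2"
  then have "3 \<le> card S" by simp
  then obtain R where R: "R \<subseteq> S" "card R = 3" using obtain_subset_with_card_n by metis
  then obtain r s t where rst: "R = {r, s, t}" "r \<noteq> s" "s \<noteq> t" "r \<noteq> t" by (auto simp: card_3_iff)
  have mem: "r \<in> S" "s \<in> S" "t \<in> S" using R(1) rst(1) by auto
  obtain a b where ab: "e = {a, b}" "a \<noteq> b" using card_edge[OF e] by (auto simp: card_2_iff)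
  have "\<exists>c. q = {a, b, c}" if "q \<in> S" for q
  proof -
    have q: "q \<in> triangles V E" "{a, b} \<subseteq> q" using S[OF that] ab by auto
    show ?thesis by (rule triangle_vertices[OF q ab(2)]) blast
  qed
  then obtain c d f where cdf: "r = {a, b, c}" "s = {a, b, d}" "t = {a, b, f}"
    using mem by metis
  have "r \<in> triangles V E \<and> inner r = {}" "s \<in> triangles V E \<and> inner s = {}"
    "t \<in> triangles V E \<and> inner t = {}"
    using S mem by simp_all
  moreover have "c \<noteq> d" "c \<noteq> f" "d \<noteq> f" using rst(2-4) cdf by auto
  ultimately show False using no_three_empty_triangles[of a b c d f] cdf by simp
qed

lemma half_rounding_empty_triangles:
  assumes w: "rational_K3_decomposition V E w" and empty: "\<And>t. t \<in> triangles V E \<Longrightarrow> inner t = {}"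
  shows "\<exists>w'. half_rounding V E w w'"
proof -
  \<comment> \<open>Any rounding will do here; the 0 is arbitrary.\<close>
  obtain \<phi> where \<phi>: "rounding \<phi>" using ex_rounding[of 0] by auto
  have range: "w t \<in> {0..1}" if "t \<in> triangles V E" for t
    using decomposition_le_one[OF simple w that] by simp
  have "half_rounding V E w (\<lambda>t. \<phi> (w t))"
  proof (rule half_roundingI)
    fix t assume t: "t \<in> triangles V E"
    show "0 \<le> w t" using decomposition_nonneg[OF w t] .
    show "2 * \<phi> (w t) \<in> \<int>" "floor2 (w t) \<le> \<phi> (w t)"
      using \<phi> decomposition_le_one[OF simple w t] unfolding rounding_def by simp_all
  next
    fix e assume e: "e \<in> E"
    show "(\<Sum>t\<in>{t \<in> triangles V E. e \<subseteq> t}. \<phi> (w t)) = 1"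
      using decomposition_sum[OF w e] decomposition_nonneg[OF w] empty finite_tri
      by (intro sum_rounding_one[OF \<phi>] card_triangles_at_edge[OF e]) auto
  qed
  then show ?thesis by blast
qed

definition inner_triangles :: "'a set \<Rightarrow> 'a set set" where
  "inner_triangles T = {t \<in> triangles V E. t \<subseteq> T \<union> inner T \<and> t \<noteq> T}"

lemma triangle_eq_if_subset:
  assumes "t \<in> triangles V E" "T \<in> triangles V E" "t \<subseteq> T"
  shows "t = T"
proof -
  have "card t = 3" "card T = 3" using assms by (simp_all add: triangles_def)
  then show ?thesis using assms(3) by (metis card_subset_eq card.infinite zero_neq_numeral)
qed

text \<open>A triangle with a vertex inside \<open>T\<close> cannot leave \<open>T\<close>, by
  \<open>edge_from_inner\<close>. Thus the inner triangles are exactly those destroyed by deleting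
  the vertices inside \<open>T\<close>.\<close>

lemma inner_triangles_iff:
  assumes "T \<in> triangles V E" "t \<in> triangles V E"
  shows "t \<in> inner_triangles T \<longleftrightarrow> t \<inter> inner T \<noteq> {}"
proof
  assume "t \<in> inner_triangles T"
  then show "t \<inter> inner T \<noteq> {}"
    using triangle_eq_if_subset[OF assms(2,1)] unfolding inner_triangles_def by blast
next
  assume "t \<inter> inner T \<noteq> {}"
  then obtain u where u: "u \<in> t" "u \<in> inner T" by blast
  have "v \<in> T \<union> inner T" if "v \<in> t" for v
    using edge_from_inner(2)[OF assms(1) triangle_edge[OF assms(2) u(1) that] u(2)] u(2)
    by (cases "u = v") auto
  moreover have "t \<noteq> T" using u inner_disjoint[OF assms(1)] by blast
  ultimately show "t \<in> inner_triangles T" using assms(2) unfolding inner_triangles_def by blast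
qed

end

section \<open>The triangles inside an innermost triangle\<close>

locale innermost_triangle = plane_graph V E p g for V :: "'a set" and E p g +
  fixes T :: "'a set"
  assumes T: "T \<in> triangles V E" and inner_T: "inner T \<noteq> {}"
    and minimal: "\<And>t. t \<in> triangles V E \<Longrightarrow> inner t \<noteq> {} \<Longrightarrow> card (inner T) \<le> card (inner t)"
begin

abbreviation H :: "'a set set" where "H \<equiv> inner_triangles T"

lemma H_triangles: "H \<subseteq> triangles V E"
  unfolding inner_triangles_def by blast

lemma finite_H: "finite H"
  using H_triangles finite_tri finite_subset by blast

text \<open>By minimality a nonempty \<open>inner t\<close> would be all of \<open>inner T\<close>.
  But \<open>t\<close> has a vertex in \<open>inner T\<close>, and no vertex of \<open>t\<close> is
  inside \<open>t\<close>.\<close>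

lemma inner_triangle_empty: "t \<in> H \<Longrightarrow> inner t = {}"
proof (rule ccontr)
  assume t: "t \<in> H" and "inner t \<noteq> {}"
  then have tri: "t \<in> triangles V E" using H_triangles by blast
  have "inner t \<subseteq> inner T" using inner_mono[OF tri T] t unfolding inner_triangles_def by blast
  moreover have "finite (inner T)" using simple unfolding inner_def simple_graph_def by simp
  moreover have "card (inner T) \<le> card (inner t)" using minimal[OF tri] \<open>inner t \<noteq> {}\<close> .
  ultimately have "inner t = inner T" by (metis card_seteq)
  then show False using inner_triangles_iff[OF T tri] t inner_disjoint[OF tri] by blast
qed

lemma card_H_le_two: "e \<in> E \<Longrightarrow> card {t \<in> H. e \<subseteq> t} \<le> 2"
  by (rule card_triangles_at_edge) (use H_triangles inner_triangle_empty in auto)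

lemma card_H_le_one:
  assumes "e \<in> E" "e \<subseteq> T"
  shows "card {t \<in> H. e \<subseteq> t} \<le> 1"
proof -
  obtain a b where ab: "e = {a, b}" "a \<noteq> b" using card_edge[OF assms(1)] by (auto simp: card_2_iff)
  obtain c where c: "T = {a, b, c}" using triangle_vertices[OF T _ ab(2)] assms(2) ab(1) by auto
  \<comment> \<open>The third vertex is not \<open>c\<close>, as \<open>s\<close> differs from
    \<open>T\<close>, so it is inside \<open>T\<close>. Two such triangles would contradict
    \<open>no_two_empty_inner_triangles\<close>.\<close>
  have apex: "\<exists>d. s = {a, b, d} \<and> d \<in> inner T" if s: "s \<in> H" "e \<subseteq> s" for s
  proof -
    have tri: "s \<in> triangles V E" "s \<subseteq> T \<union> inner T" "s \<noteq> T"
      using s(1) unfolding inner_triangles_def by auto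
    obtain d where d: "s = {a, b, d}" "d \<noteq> a" "d \<noteq> b"
      using triangle_vertices[OF tri(1) _ ab(2)] s(2) ab(1) by auto
    then have "d \<noteq> c" using tri(3) c by blast
    then show ?thesis using d tri(2) c by blast
  qed
  have "s = t" if st: "s \<in> H" "e \<subseteq> s" "t \<in> H" "e \<subseteq> t" for s t
  proof (rule ccontr)
    assume "s \<noteq> t"
    obtain d f where d: "s = {a, b, d}" "d \<in> inner T" and f: "t = {a, b, f}" "f \<in> inner T"
      using apex[OF st(1,2)] apex[OF st(3,4)] by blast
    have "d \<noteq> f" using \<open>s \<noteq> t\<close> d f by blast
    moreover have "s \<in> triangles V E" "t \<in> triangles V E" using st H_triangles by auto
    ultimately show False
      using no_two_empty_inner_triangles[of a b c d f] T c d f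
        inner_triangle_empty[OF st(1)] inner_triangle_empty[OF st(3)] by simp
  qed
  then show ?thesis using finite_H by (simp add: card_le_Suc0_iff_eq)
qed

lemma inner_edge_triangles:
  assumes "e \<inter> inner T \<noteq> {}"
  shows "{t \<in> triangles V E. e \<subseteq> t} = {t \<in> H. e \<subseteq> t}"
proof (intro Collect_cong iffI conjI)
  fix t assume t: "t \<in> triangles V E \<and> e \<subseteq> t"
  then have "t \<inter> inner T \<noteq> {}" using assms by blast
  then show "t \<in> H" using inner_triangles_iff[OF T] t by blast
qed (use H_triangles in auto)

lemma sum_outer_edge:
  assumes "e \<in> E" "e \<inter> inner T = {}" "\<not> e \<subseteq> T"
  shows "sum f {t \<in> H. e \<subseteq> t} = 0"
proof -
  have "{t \<in> H. e \<subseteq> t} = {}" using assms unfolding inner_triangles_def by blast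
  then show ?thesis by (simp only: sum.empty)
qed

text \<open>\<open>R\<close> consists of the edges of \<open>T\<close> that the inner triangles saturate; the inner triangles
  contribute \<open>x\<close> to the other edges of \<open>T\<close>. Removing an edge in \<open>R\<close> destroys only outer triangles of
  weight \<open>0\<close>, and if \<open>R\<close> is empty the missing contribution \<open>x\<close> is transferred to \<open>T\<close>.\<close>

lemma half_rounding_from_outside:
  assumes w: "rational_K3_decomposition V E w"
    and R: "\<And>e. e \<in> R \<Longrightarrow> e \<in> E \<and> e \<subseteq> T" and xR: "R = {} \<or> x = 0" and x: "0 \<le> x" "x \<le> 1"
    and c: "\<And>e. e \<in> E \<Longrightarrow> e \<subseteq> T \<Longrightarrow> sum w {t \<in> H. e \<subseteq> t} = (if e \<in> R then 1 else x)"
    and IH: "\<And>V' E' w. card V' < card V \<Longrightarrow> simple_graph V' E' \<Longrightarrow> plane_drawing V' E' p g \<Longrightarrow>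
      rational_K3_decomposition V' E' w \<Longrightarrow> \<exists>w'. half_rounding V' E' w w'"
  shows "\<exists>w'. half_rounding V E w w'"
proof -
  define V' where "V' = V - inner T"
  define E' where "E' = {e \<in> E. e \<subseteq> V' \<and> e \<notin> R}"
  \<comment> \<open>If \<open>R\<close> is nonempty, \<open>T\<close> loses an edge, but then
    \<open>x = 0\<close> and no weight has to be transferred.\<close>
  define w0 where "w0 = w(T := w T + x)"
  let ?tri = "triangles V E" and ?tri' = "triangles V' E'"
  have finV: "finite V" and inner_V: "inner T \<subseteq> V"
    using simple unfolding simple_graph_def inner_def by auto
  have smaller: "card V' < card V"
    using finV inner_V inner_T unfolding V'_def by (intro psubset_card_mono) auto
  have simple': "simple_graph V' E'"
    using simple unfolding simple_graph_def V'_def E'_def by auto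
  have drawing': "plane_drawing V' E' p g"
    by (rule plane_drawing_subgraph[OF drawing]) (auto simp: V'_def E'_def)
  \<comment> \<open>These triangles are lost only through the removal of \<open>R\<close>;
    \<open>T\<close> is among them when \<open>R\<close> is nonempty.\<close>
  define D where "D = {t \<in> ?tri. t \<inter> inner T = {} \<and> (\<exists>e\<in>R. e \<subseteq> t)}"
  have tri': "?tri' = {t \<in> ?tri. t \<inter> inner T = {} \<and> \<not> (\<exists>e\<in>R. e \<subseteq> t)}"
  proof (intro equalityI subsetI)
    fix t assume t: "t \<in> ?tri'"
    have False if e: "e \<in> R" "e \<subseteq> t" for e
    proof -
      obtain u v where uv: "e = {u, v}" "u \<noteq> v"
        using R[OF e(1)] card_edge by (metis card_2_iff)
      then have "e \<in> E'" using triangle_edge[OF t, of u v] e(2) by simp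
      then show False using e(1) by (simp add: E'_def)
    qed
    moreover have "t \<in> ?tri" "t \<inter> inner T = {}"
      using t unfolding triangles_def E'_def V'_def by auto
    ultimately show "t \<in> {t \<in> ?tri. t \<inter> inner T = {} \<and> \<not> (\<exists>e\<in>R. e \<subseteq> t)}" by blast
  next
    fix t assume t: "t \<in> {t \<in> ?tri. t \<inter> inner T = {} \<and> \<not> (\<exists>e\<in>R. e \<subseteq> t)}"
    then have "t \<subseteq> V'" "card t = 3" unfolding triangles_def V'_def by auto
    moreover have "{u, v} \<in> E'" if "u \<in> t" "v \<in> t" "u \<noteq> v" for u v
      using triangle_edge[of t V E u v] t that \<open>t \<subseteq> V'\<close> unfolding E'_def by auto
    ultimately show "t \<in> ?tri'" unfolding triangles_def by blast
  qed
  have H_iff: "t \<in> H \<longleftrightarrow> t \<in> ?tri \<and> t \<inter> inner T \<noteq> {}" for t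
    using inner_triangles_iff[OF T] H_triangles by blast
  have split: "sum f {t \<in> ?tri. e \<subseteq> t} =
      sum f {t \<in> ?tri'. e \<subseteq> t} + sum f {t \<in> D. e \<subseteq> t} + sum f {t \<in> H. e \<subseteq> t}"
    for f :: "'a set \<Rightarrow> rat" and e
  proof -
    have "{t \<in> ?tri. e \<subseteq> t} = {t \<in> ?tri'. e \<subseteq> t} \<union> {t \<in> D. e \<subseteq> t} \<union> {t \<in> H. e \<subseteq> t}"
      unfolding tri' D_def using H_iff by blast
    moreover have "finite {t \<in> ?tri'. e \<subseteq> t}" "finite {t \<in> D. e \<subseteq> t}" "finite {t \<in> H. e \<subseteq> t}"
      using finite_tri finite_H unfolding tri' D_def by auto
    moreover have "{t \<in> ?tri'. e \<subseteq> t} \<inter> {t \<in> D. e \<subseteq> t} = {}"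
      "({t \<in> ?tri'. e \<subseteq> t} \<union> {t \<in> D. e \<subseteq> t}) \<inter> {t \<in> H. e \<subseteq> t} = {}"
      unfolding tri' D_def using H_iff by blast+
    ultimately show ?thesis by (simp add: sum.union_disjoint)
  qed
  have w_nonneg: "0 \<le> w t" and w_le: "w t \<le> 1" if "t \<in> ?tri" for t
    using decomposition_le_one[OF simple w that] by auto
  have w_sum: "sum w {t \<in> ?tri. e \<subseteq> t} = 1" if "e \<in> E" for e
    using decomposition_sum[OF w that] .
  \<comment> \<open>An edge in \<open>R\<close> receives its full sum 1 from the inner triangles, so
    nonnegativity leaves weight 0 for the others.\<close>
  have w_D: "w t = 0" if t: "t \<in> D" for t
  proof -
    obtain e where e: "e \<in> R" "e \<subseteq> t" using t unfolding D_def by blast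
    have "sum w {t \<in> ?tri'. e \<subseteq> t} + sum w {t \<in> D. e \<subseteq> t} = 0"
      using split[of w e] w_sum[of e] c[of e] R[OF e(1)] e(1) by simp
    moreover have "0 \<le> sum w {t \<in> ?tri'. e \<subseteq> t}" "0 \<le> sum w {t \<in> D. e \<subseteq> t}"
      using w_nonneg unfolding tri' D_def by (auto intro!: sum_nonneg)
    ultimately have zero: "sum w {t \<in> D. e \<subseteq> t} = 0" by linarith
    have "finite {t \<in> D. e \<subseteq> t}" using finite_tri unfolding D_def by simp
    moreover have "0 \<le> w s" if "s \<in> {t \<in> D. e \<subseteq> t}" for s
      using w_nonneg that unfolding D_def by blast
    moreover have "t \<in> {t \<in> D. e \<subseteq> t}" using t e(2) by blast
    ultimately show ?thesis using sum_nonneg_0[OF _ _ zero] by blast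
  qed
  have T_tri': "T \<in> ?tri' \<longleftrightarrow> R = {}"
    using T R inner_disjoint[OF T] unfolding tri' by blast
  \<comment> \<open>Used in both directions: to add \<open>x\<close> to \<open>T\<close> for the
    smaller graph, and to take \<open>floor2 x\<close> back afterwards.\<close>
  have sum_upd: "sum (f(T := f T + y)) {t \<in> ?tri'. e \<subseteq> t} =
      sum f {t \<in> ?tri'. e \<subseteq> t} + (if e \<subseteq> T then y else 0)"
    if "R = {} \<or> y = 0" for f :: "'a set \<Rightarrow> rat" and e y
  proof (cases "y = 0")
    case False
    then have "T \<in> ?tri'" using that T_tri' by blast
    have "sum (f(T := f T + y)) {t \<in> ?tri'. e \<subseteq> t} =
        (\<Sum>t\<in>{t \<in> ?tri'. e \<subseteq> t}. f t + (if t = T then y else 0))"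
      by (intro sum.cong) auto
    also have "\<dots> = sum f {t \<in> ?tri'. e \<subseteq> t} + (\<Sum>t\<in>{t \<in> ?tri'. e \<subseteq> t}. if t = T then y else 0)"
      by (rule sum.distrib)
    finally show ?thesis using \<open>T \<in> ?tri'\<close> finite_tri unfolding tri' by simp
  qed simp
  have "rational_K3_decomposition V' E' w0"
    unfolding rational_K3_decomposition_def
  proof (intro conjI ballI)
    fix t assume "t \<in> ?tri'"
    then show "0 \<le> w0 t" using w_nonneg x unfolding tri' w0_def by auto
  next
    fix e assume "e \<in> E'"
    then have e: "e \<in> E" "e \<inter> inner T = {}" "e \<notin> R" unfolding E'_def V'_def by auto
    have "sum w {t \<in> ?tri'. e \<subseteq> t} + sum w {t \<in> H. e \<subseteq> t} = 1"
      using split[of w e] w_sum[OF e(1)] w_D by simp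
    moreover have "sum w {t \<in> H. e \<subseteq> t} = (if e \<subseteq> T then x else 0)"
      using c[OF e(1)] sum_outer_edge[OF e(1,2), where f = w] e(3) by presburger
    ultimately show "sum w0 {t \<in> ?tri'. e \<subseteq> t} = 1"
      using sum_upd[OF xR, of w e] by (simp add: w0_def)
  qed
  then obtain w1 where w1: "rational_K3_decomposition V' E' w1"
    and w1_half: "\<And>t. t \<in> ?tri' \<Longrightarrow> 2 * w1 t \<in> \<int> \<and> floor2 (w0 t) \<le> w1 t"
    using IH[OF smaller simple' drawing'] unfolding half_rounding_def by blast
  \<comment> \<open>With this choice the inner triangles contribute, at each edge of
    \<open>T\<close> not in \<open>R\<close>, exactly the amount \<open>floor2 x\<close> that
    \<open>T\<close> gives up.\<close>
  obtain \<phi> where \<phi>: "rounding \<phi>" and \<phi>x: "\<phi> x = floor2 x" using ex_rounding[OF x] .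
  define w3 where "w3 = w1(T := w1 T + (- floor2 x))"
  \<comment> \<open>The default 0 is the value on \<open>D\<close>, where the old weight is 0
    too.\<close>
  define w2 where "w2 t = (if t \<in> H then \<phi> (w t) else if t \<in> ?tri' then w3 t else 0)" for t
  have w3: "2 * w3 t \<in> \<int>" "floor2 (w t) \<le> w3 t" if t: "t \<in> ?tri'" for t
  proof -
    show "2 * w3 t \<in> \<int>"
      using w1_half[OF t] Ints_diff[OF _ half_integral_floor2[of x]]
      unfolding w3_def by (auto simp: right_diff_distrib)
    \<comment> \<open>For \<open>t = T\<close> with \<open>R\<close> empty: \<open>w1 T\<close> is
      at least \<open>floor2 (w T + x)\<close>, hence at least
      \<open>floor2 (w T) + floor2 x\<close>.\<close>
    show "floor2 (w t) \<le> w3 t"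
      using w1_half[OF t] floor2_add[of "w T" x] unfolding w3_def w0_def by (auto split: if_splits)
  qed
  have H_range: "w t \<in> {0..1}" if "t \<in> H" for t using that w_nonneg w_le H_triangles by auto
  have lower: "2 * w2 t \<in> \<int>" "floor2 (w t) \<le> w2 t" if t: "t \<in> ?tri" for t
  proof -
    consider "t \<in> H" | "t \<notin> H" "t \<in> ?tri'" | "t \<notin> H" "t \<notin> ?tri'" by blast
    then have "2 * w2 t \<in> \<int> \<and> floor2 (w t) \<le> w2 t"
    proof cases
      case 1
      then show ?thesis using \<phi> H_range[OF 1] 1 unfolding rounding_def w2_def by simp
    next
      case 2
      then show ?thesis using w3 unfolding w2_def by simp
    next
      case 3
      then have "t \<in> D" using t H_iff unfolding tri' D_def by blast
      then show ?thesis using 3 w_D by (simp add: w2_def floor2_def)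
    qed
    then show "2 * w2 t \<in> \<int>" "floor2 (w t) \<le> w2 t" by auto
  qed
  have sum_H: "sum w2 {t \<in> H. e \<subseteq> t} = (\<Sum>t\<in>{t \<in> H. e \<subseteq> t}. \<phi> (w t))" for e
    by (intro sum.cong) (auto simp: w2_def)
  have sum_D: "sum w2 {t \<in> D. e \<subseteq> t} = 0" for e
    by (intro sum.neutral) (auto simp: w2_def D_def tri' H_iff)
  have sum_tri': "sum w2 {t \<in> ?tri'. e \<subseteq> t} = sum w3 {t \<in> ?tri'. e \<subseteq> t}" for e
    by (intro sum.cong) (auto simp: w2_def tri' H_iff)
  have w2_sum: "sum w2 {t \<in> ?tri. e \<subseteq> t} = 1" if e: "e \<in> E" for e
  proof (cases "e \<inter> inner T = {}")
    case False
    have "sum w {t \<in> H. e \<subseteq> t} = 1"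
      using w_sum[OF e] inner_edge_triangles[OF False] by simp
    then have "(\<Sum>t\<in>{t \<in> H. e \<subseteq> t}. \<phi> (w t)) = 1"
      using H_range finite_H by (intro sum_rounding_one[OF \<phi>] card_H_le_two[OF e]) auto
    then show ?thesis using inner_edge_triangles[OF False] sum_H by simp
  next
    case True
    \<comment> \<open>At most one inner triangle lies on an edge of \<open>T\<close>, so rounding
      commutes with the sum and gives \<open>\<phi> 1 = 1\<close> or
      \<open>\<phi> x = floor2 x\<close>.\<close>
    have in_H: "sum w2 {t \<in> H. e \<subseteq> t} = (if e \<subseteq> T then if e \<in> R then 1 else floor2 x else 0)"
    proof (cases "e \<subseteq> T")
      case sub: True
      have "(\<Sum>t\<in>{t \<in> H. e \<subseteq> t}. \<phi> (w t)) = \<phi> (sum w {t \<in> H. e \<subseteq> t})"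
        using finite_H by (intro sum_rounding_single[OF \<phi>] card_H_le_one[OF e sub]) auto
      then show ?thesis using sum_H[of e] c[OF e sub] sub \<phi> \<phi>x by (simp add: rounding_def)
    next
      case False
      then show ?thesis using sum_outer_edge[OF e True False] by simp
    qed
    show ?thesis
    proof (cases "e \<in> R")
      case eR: True
      then have "{t \<in> ?tri'. e \<subseteq> t} = {}" unfolding tri' by blast
      then have "sum w2 {t \<in> ?tri'. e \<subseteq> t} = 0" by (simp only: sum.empty)
      then show ?thesis using split[of w2 e] in_H sum_D[of e] eR R[OF eR] by simp
    next
      case False
      then have "e \<in> E'" using e True edge_subset[OF e] unfolding E'_def V'_def by blast
      then have "sum w1 {t \<in> ?tri'. e \<subseteq> t} = 1"
        using decomposition_sum[OF w1] by blast
      moreover have "R = {} \<or> - floor2 x = 0" using xR by (auto simp: floor2_def)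
      ultimately have "sum w3 {t \<in> ?tri'. e \<subseteq> t} = 1 + (if e \<subseteq> T then - floor2 x else 0)"
        using sum_upd[of "- floor2 x" w1 e] unfolding w3_def by simp
      then show ?thesis using split[of w2 e] in_H sum_D[of e] sum_tri'[of e] False by simp
    qed
  qed
  have "half_rounding V E w w2"
    using w_nonneg lower w2_sum by (rule half_roundingI)
  then show ?thesis by blast
qed

lemma half_rounding_step:
  assumes w: "rational_K3_decomposition V E w"
    and IH: "\<And>V' E' w. card V' < card V \<Longrightarrow> simple_graph V' E' \<Longrightarrow> plane_drawing V' E' p g \<Longrightarrow>
      rational_K3_decomposition V' E' w \<Longrightarrow> \<exists>w'. half_rounding V' E' w w'"
  shows "\<exists>w'. half_rounding V E w w'"
proof -
  let ?c = "\<lambda>e. sum w {t \<in> H. e \<subseteq> t}"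
  have cardT: "card T = 3" using T by (simp add: triangles_def)
  have T_edge: "e \<in> E" if "e \<subseteq> T" "card e = 2" for e
    using triangle_edge[OF T] that by (auto simp: card_2_iff)
  have w_nonneg: "0 \<le> w t" if "t \<in> triangles V E" for t
    using decomposition_nonneg[OF w that] .
  have w_sum: "sum w {t \<in> triangles V E. e \<subseteq> t} = 1" if "e \<in> E" for e
    using decomposition_sum[OF w that] .
  have c_range: "0 \<le> ?c e" "?c e \<le> 1" if "e \<in> E" for e
  proof -
    show "0 \<le> ?c e" using w_nonneg H_triangles by (intro sum_nonneg) auto
    have "?c e \<le> sum w {t \<in> triangles V E. e \<subseteq> t}"
      using w_nonneg H_triangles finite_tri by (intro sum_mono2) auto
    then show "?c e \<le> 1" using w_sum[OF that] by simp
  qed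
  have inner_sum: "?c e = 1 \<and> card {s \<in> H. e \<subseteq> s} \<le> 2"
    if t: "t \<in> H" "e \<subseteq> t" "card e = 2" "\<not> e \<subseteq> T" for t e
  proof -
    have "e \<in> E" using triangle_edge[of t V E] t H_triangles by (auto simp: card_2_iff)
    moreover have "e \<inter> inner T \<noteq> {}" using t unfolding inner_triangles_def by blast
    ultimately show ?thesis using w_sum inner_edge_triangles card_H_le_two by metis
  qed
  have "(\<exists>x. \<forall>e. e \<subseteq> T \<and> card e = 2 \<longrightarrow> ?c e = x) \<or> (\<forall>e. e \<subseteq> T \<and> card e = 2 \<longrightarrow> ?c e \<in> {0, 1})"
  proof (rule boundary_dichotomy[OF finite_H _ cardT inner_sum])
    show "card t = 3 \<and> 0 \<le> w t" if "t \<in> H" for t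
    proof -
      have "t \<in> triangles V E" using that H_triangles by blast
      then show ?thesis using w_nonneg[of t] by (simp add: triangles_def)
    qed
    show "card {s \<in> H. e \<subseteq> s} \<le> 1 \<and> ?c e \<le> 1" if "e \<subseteq> T" "card e = 2" for e
      using card_H_le_one[OF T_edge[OF that] that(1)] c_range(2)[OF T_edge[OF that]] by blast
  qed
  then show ?thesis
  proof
    assume "\<exists>x. \<forall>e. e \<subseteq> T \<and> card e = 2 \<longrightarrow> ?c e = x"
    then obtain x where x: "\<forall>e. e \<subseteq> T \<and> card e = 2 \<longrightarrow> ?c e = x" ..
    obtain e where e: "e \<subseteq> T" "card e = 2" using obtain_subset_with_card_n[of 2 T] cardT by auto
    then have "?c e = x" using x by blast
    then have "0 \<le> x" "x \<le> 1" using c_range[OF T_edge[OF e]] by auto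
    have c_x: "?c e = (if e \<in> {} then 1 else x)" if "e \<in> E" "e \<subseteq> T" for e
      using x card_edge[OF that(1)] that(2) by simp
    show ?thesis
      by (rule half_rounding_from_outside[OF w, of "{}" x, OF _ _ \<open>0 \<le> x\<close> \<open>x \<le> 1\<close> c_x IH]) simp_all
  next
    assume c: "\<forall>e. e \<subseteq> T \<and> card e = 2 \<longrightarrow> ?c e \<in> {0, 1}"
    let ?R = "{e \<in> E. e \<subseteq> T \<and> ?c e = 1}"
    have c_R: "?c e = (if e \<in> ?R then 1 else 0)" if e: "e \<in> E" "e \<subseteq> T" for e
    proof -
      have "?c e \<in> {0, 1}" using c card_edge[OF e(1)] e(2) by blast
      then show ?thesis using e by auto
    qed
    show ?thesis
      by (rule half_rounding_from_outside[OF w, of ?R 0, OF _ _ _ _ c_R IH]) simp_all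
  qed
qed

end

section \<open>Induction on the number of vertices\<close>

lemma ex_half_rounding:
  assumes "simple_graph V E" "plane_drawing V E p g" "rational_K3_decomposition V E w"
  shows "\<exists>w'. half_rounding V E w w'"
  using assms
\<comment> \<open>The maps \<open>p\<close> and \<open>g\<close> stay fixed, as they also draw every
  subgraph; \<open>w\<close> must vary, since the weight of the innermost triangle may be
  raised.\<close>
proof (induction "card V" arbitrary: V E w rule: less_induct)
  case less
  interpret plane_graph V E p g by unfold_locales (use less.prems in auto)
  show ?case
  proof (cases "\<forall>t\<in>triangles V E. inner t = {}")
    case True
    then show ?thesis using half_rounding_empty_triangles[OF less.prems(3)] by simp
  next
    case False
    let ?P = "\<lambda>t. t \<in> triangles V E \<and> inner t \<noteq> {}"
    have "\<exists>t. ?P t" using False by blast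
    then obtain T where "?P T \<and> (\<forall>t. ?P t \<longrightarrow> card (inner T) \<le> card (inner t))"
      using ex_has_least_nat[of ?P _ "\<lambda>t. card (inner t)"] by metis
    then interpret innermost_triangle V E p g T by unfold_locales auto
    show ?thesis by (rule half_rounding_step[OF less.prems(3) less.hyps])
  qed
qed

theorem theorem7:
  fixes V :: "'a set" and E :: "'a set set"
  assumes "simple_graph V E"
    and "planar_graph V E"
    and "rationally_K3_decomposable V E"
  shows "\<exists>w. rational_K3_decomposition V E w \<and> (\<forall>t\<in>triangles V E. w t \<in> {0, 1, 1/2})"
proof -
  obtain p g w where "plane_drawing V E p g" "rational_K3_decomposition V E w"
    using assms(2,3) unfolding planar_graph_def rationally_K3_decomposable_def by blast
  then obtain w' where w': "rational_K3_decomposition V E w'"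
    and half: "\<And>t. t \<in> triangles V E \<Longrightarrow> 2 * w' t \<in> \<int>"
    using ex_half_rounding[OF assms(1)] unfolding half_rounding_def by blast
  have "w' t \<in> {0, 1, 1/2}" if t: "t \<in> triangles V E" for t
  proof -
    obtain k where k: "2 * w' t = of_int k" using half[OF t] by (rule Ints_cases)
    have "0 \<le> w' t" "w' t \<le> 1" using decomposition_le_one[OF assms(1) w' t] by auto
    then have "of_int 0 \<le> (of_int k :: rat)" "of_int k \<le> (of_int 2 :: rat)" using k by auto
    then have "k = 0 \<or> k = 1 \<or> k = 2" unfolding of_int_le_iff by linarith
    then show ?thesis using k by auto
  qed
  with w' show ?thesis by blast
qed

end
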